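(* Every $3$-dimensional lattice parallelepiped $P\subset\mathbb{R}^3$ has a unimodular cover.
   Context: The lattice is $\mathbb{Z}^3\subset\mathbb{R}^3$. A lattice polytope is the convex hull of finitely many lattice points; a lattice parallelepiped is a parallelepiped (affine image of the cube $[0,1]^3$) all of whose vertices are lattice points. A unimodular tetrahedron is a lattice tetrahedron whose edge vectors from one vertex form a basis of $\mathbb{Z}^3$ (normalized volume $1$). A unimodular cover of a lattice polytope $P\subset\mathbb{R}^3$ of dimension $3$ is a collection of unimodular tetrahedra whose union equals $P$. *)

theory Defs
  imports "HOL-Analysis.Analysis"
begin

definition int_points :: "(real ^ 3) set" where
  "int_points = {x. \<forall>i. x $ i \<in> \<int>}"

definition parallelepiped :: "(real ^ 3) set \<Rightarrow> bool" where
  "parallelepiped P \<longleftrightarrow> (\<exists>c f. linear f \<and> P = (\<lambda>x. c + f x) ` cbox (0 :: real ^ 3) 1)"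

text \<open>Affine images may be degenerate here; three-dimensionality is a separate hypothesis.\<close>

definition lattice_parallelepiped :: "(real ^ 3) set \<Rightarrow> bool" where
  "lattice_parallelepiped P \<longleftrightarrow>
     parallelepiped P \<and> {v. v extreme_point_of P} \<subseteq> int_points"

definition int_scale :: "int \<Rightarrow> real ^ 3 \<Rightarrow> real ^ 3" where
  "int_scale n x = of_int n *\<^sub>R x"

interpretation int_module: module int_scale
  by unfold_locales (simp_all add: int_scale_def algebra_simps)

text \<open>A basis over the integers, not over the reals: \<open>int_module.span\<close> consists of the
  integer linear combinations.\<close>

definition int_basis :: "(real ^ 3) set \<Rightarrow> bool" where
  "int_basis B \<longleftrightarrow> int_module.independent B \<and> int_module.span B = int_points"

definition unimodular_tetrahedron :: "(real ^ 3) set \<Rightarrow> bool" where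
  "unimodular_tetrahedron T \<longleftrightarrow>
     (\<exists>V. V \<subseteq> int_points \<and> card V = 4 \<and> \<not> affine_dependent V \<and> T = convex hull V \<and>
          (\<exists>a\<in>V. int_basis ((\<lambda>v. v - a) ` (V - {a}))))"

definition unimodular_cover :: "(real ^ 3) set set \<Rightarrow> (real ^ 3) set \<Rightarrow> bool" where
  "unimodular_cover \<T> P \<longleftrightarrow> (\<forall>T\<in>\<T>. unimodular_tetrahedron T) \<and> \<Union>\<T> = P"

end

theory Submission
  imports Defs "HOL-Computational_Algebra.Primes"
begin

text \<open>
  A parallelepiped is the convex hull of its extreme points, so every point \<open>x\<close> of it lies in a
  nondegenerate tetrahedron spanned by some of them, by the Caratheodory theorem. It remains to pass,
  for any lattice tetrahedron \<open>T\<close> in \<open>P\<close> with \<open>x \<in> T\<close>, to a unimodular one; this is done by induction on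
  the normalized volume of \<open>T\<close>.

  Let \<open>e\<close> be a point of \<open>P\<close> with barycentric coordinates \<open>\<lambda>\<^sub>i\<close> relative to \<open>T\<close>. The tetrahedra obtained
  by replacing a vertex \<open>v\<^sub>i\<close> with \<open>\<lambda>\<^sub>i > 0\<close> by \<open>e\<close> cover \<open>T\<close> (\<open>convex_hull_exchange4\<close>), and the
  replacement multiplies the volume by \<open>\<lambda>\<^sub>i\<close>. So it suffices to find, when the volume of \<open>T\<close> is not 1, a
  lattice point \<open>e\<close> of \<open>P\<close> all of whose barycentric coordinates are less than 1
  (\<open>reducible_nonunimodular\<close>).

  As \<open>T\<close> is not unimodular, some lattice point has barycentric coordinates \<open>n\<^sub>i / p\<close>, not all integral, with
  \<open>p\<close> prime. For every \<open>k\<close> the residues \<open>k n\<^sub>i mod p\<close>, divided by \<open>p\<close>, are the weights of a lattice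
  vector. If for some \<open>k\<close> they sum to 1, this vector is a point of \<open>T\<close> and serves as \<open>e\<close>. Otherwise, as \<open>k\<close>
  and \<open>p - k\<close> give opposite residues, the weights sum to 2 for every \<open>k\<close> not divisible by \<open>p\<close>. An
  elementary argument on floor functions, which is the arithmetic core of the theorem of White on empty
  tetrahedra, then shows that the weights pair off: up to the order of the vertices they
  are \<open>x, 1 - x, 1 - t, t\<close> (\<open>residue_sums_pairing\<close>).

  Finally let \<open>y = x a + (1 - x) b + (1 - t) c + t d\<close> be that lattice vector, with \<open>t\<close> the largest weight, and
  \<open>z = a + b + c + d - y\<close>. The lattice points \<open>y - a\<close>, \<open>y - b\<close>, \<open>y - d\<close> and \<open>z - c\<close> have barycentric
  coordinates less than 1. In the coordinates that turn \<open>P\<close> into the unit cube, each of the three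
  coordinate conditions excludes at most one of these four points
  (\<open>cube_coordinate\<close>), so one of them lies in \<open>P\<close>.
\<close>

section \<open>Residues with constant sums pair off\<close>

text \<open>
  The sequences \<open>\<lfloor>kA/p\<rfloor>\<close> and \<open>\<lfloor>kB/p\<rfloor>\<close> cannot add up to \<open>\<lfloor>kC/p\<rfloor>\<close>, where \<open>C = A + B - 1\<close> and
  \<open>1 < A \<le> B\<close>. The jumps of the three sequences are nearly evenly spaced, and the gaps for \<open>B\<close>
  and \<open>C\<close> have about the same length because their first jumps coincide. At the
  first jump of \<open>A\<close> the sequence of \<open>B\<close> does not move, so two consecutive jumps of \<open>B\<close> enclose it,
  leaving room for three jumps of \<open>C\<close> in a span that is too short for them.
\<close>

lemma floor_sums_no_merge:
  fixes A B C p :: nat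
  assumes p: "prime p" and A: "1 < A" and AB: "A \<le> B" and C: "A + B = C + 1" and Cp: "2 * C < p"
    and eq: "\<And>k. k < p \<Longrightarrow> (k * A) div p + (k * B) div p = (k * C) div p"
  shows False
proof -
  have p0: "0 < p" using p by (simp add: prime_gt_0_nat)
  have ndvd: "\<not> p dvd k * m" if "0 < k" "k < p" "0 < m" "m < p" for k m
    using that p by (auto simp: prime_dvd_mult_iff dest: dvd_imp_le)
  \<comment> \<open>\<open>t\<close> is the first jump of \<open>C\<close>; it is also a jump of \<open>B\<close>, but not of \<open>A\<close>\<close>
  define t where "t = (LEAST t. p \<le> t * C)"
  have "p \<le> (p - 1) * C"
  proof -
    have "p \<le> (p - 1) * 2" using p prime_ge_2_nat[OF p] by simp
    also have "\<dots> \<le> (p - 1) * C" using A AB C by (intro mult_left_mono) auto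
    finally show ?thesis .
  qed
  then have t1: "p \<le> t * C" and tp: "t \<le> p - 1"
    unfolding t_def by (auto intro: LeastI Least_le)
  have t0: "0 < t" using t1 p0 by (cases t) auto
  have t2: "(t - 1) * C < p"
    using not_less_Least[of "t - 1" "\<lambda>t. p \<le> t * C"] t0 unfolding t_def[symmetric] by simp
  have tC: "t * C = (t - 1) * C + C" using t0 by (cases t) auto
  have fCt: "(t * C) div p = 1"
    using t1 t2 tC Cp by (intro div_nat_eqI) auto
  have "(t * A) div p \<le> (t * B) div p" using AB by (intro div_le_mono) auto
  moreover have "(t * A) div p + (t * B) div p = 1" using eq[of t] fCt tp p0 by simp
  ultimately have fAt: "(t * A) div p = 0" and fBt: "(t * B) div p = 1" by linarith+
  have tA: "t * A < p" using fAt p0 by (simp add: div_eq_0_iff)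
  have tB: "p \<le> t * B" "t * B < 2 * p"
    using fBt p0 by (metis One_nat_def div_greater_zero_iff lessI)
      (metis fBt div_less_iff_less_mult lessI numeral_2_eq_2 One_nat_def p0)
  have Bp: "B < p" using C Cp A by linarith
  have tB': "p < t * B" using tB ndvd[of t B] t0 tp p0 Bp A AB by (cases "p = t * B") auto
  \<comment> \<open>\<open>s\<close> is the first jump of \<open>A\<close>; as \<open>A > 1\<close>, reflection in \<open>p\<close> shows that it comes no later than \<open>p - t\<close>\<close>
  define s where "s = (LEAST s. p \<le> s * A)"
  have pt: "p \<le> (p - t) * A"
  proof -
    have "(p - t) * A = p * A - t * A" by (simp add: diff_mult_distrib)
    moreover have "p * 2 \<le> p * A" using A by (intro mult_left_mono) auto
    ultimately show ?thesis using tA by linarith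
  qed
  have s1: "p \<le> s * A" unfolding s_def by (rule LeastI, rule pt)
  have spt: "s \<le> p - t" unfolding s_def by (rule Least_le, rule pt)
  have s0: "0 < s" using s1 p0 by (cases s) auto
  have s2: "(s - 1) * A < p"
    using not_less_Least[of "s - 1" "\<lambda>t. p \<le> t * A"] s0 unfolding s_def[symmetric] by simp
  have ts: "t < s"
  proof (rule ccontr)
    assume "\<not> t < s"
    then have "s * A \<le> t * A" by simp
    then show False using s1 tA by linarith
  qed
  define j where "j = (s * B) div p"
  have j1: "1 \<le> j"
  proof -
    have "t * B \<le> s * B" using ts by simp
    then have "p \<le> s * B" using tB by linarith
    then show ?thesis unfolding j_def using p0 by (simp add: Suc_le_eq div_greater_zero_iff)
  qed
  have jB: "j + 2 \<le> B"
  proof -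
    have "s * B \<le> (p - t) * B" using spt by simp
    also have "\<dots> = p * B - t * B" by (simp add: diff_mult_distrib)
    finally have "s * B < p * B - p" using tB' tB A AB
      by (smt (verit) diff_less_mono2 le_trans less_le_trans linorder_not_le mult_le_mono1 mult.commute nat_less_le
          tp diff_le_self)
    also have "p * B - p = (B - 1) * p" by (cases B) (auto simp: algebra_simps)
    finally have "j < B - 1" unfolding j_def using p0 by (simp add: div_less_iff_less_mult)
    then show ?thesis by linarith
  qed
  have sB: "j * p \<le> s * B" "s * B < (j + 1) * p"
    unfolding j_def using p0 by (simp, metis add.commute dividend_less_div_times mult.commute mult_Suc plus_1_eq_Suc)
  have sp: "s < p" using spt t0 tp p0 by linarith
  \<comment> \<open>\<open>C\<close> jumps by at most 1, and \<open>A\<close> already jumps at \<open>s\<close>, so \<open>B\<close> cannot\<close>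
  have fBs1: "j \<le> ((s - 1) * B) div p"
  proof -
    have "((s - 1) * A) div p + ((s - 1) * B) div p = ((s - 1) * C) div p"
      using eq[of "s - 1"] sp by simp
    moreover have "((s - 1) * A) div p = 0" using s2 by simp
    moreover have "1 \<le> (s * A) div p" using s1 p0 by (simp add: Suc_le_eq div_greater_zero_iff)
    moreover have "(s * A) div p + j = (s * C) div p" using eq[of s] sp unfolding j_def by simp
    moreover have "(s * C) div p \<le> ((s - 1) * C + p) div p"
      using Cp s0 by (intro div_le_mono) (cases s, auto)
    moreover have "((s - 1) * C + p) div p = ((s - 1) * C) div p + 1" using p0 by simp
    ultimately show ?thesis by linarith
  qed
  then have s1B: "j * p \<le> (s - 1) * B" using p0 by (simp add: less_eq_div_iff_mult_less_eq)
  \<comment> \<open>\<open>v\<close> and \<open>u\<close> are the jumps of \<open>B\<close> before and after \<open>s\<close>\<close>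
  define v where "v = (LEAST v. j * p \<le> v * B)"
  have v1: "j * p \<le> v * B" unfolding v_def by (rule LeastI, rule s1B)
  have vs: "v \<le> s - 1" unfolding v_def by (rule Least_le, rule s1B)
  have v0: "0 < v" using v1 p0 j1 by (cases v) auto
  have v2: "(v - 1) * B < j * p"
    using not_less_Least[of "v - 1" "\<lambda>t. j * p \<le> t * B"] v0 unfolding v_def[symmetric] by simp
  define u where "u = (LEAST u. (j + 1) * p \<le> u * B)"
  have up: "(j + 1) * p \<le> (p - 1) * B"
  proof -
    have "(j + 1) * p \<le> (B - 1) * p" using jB by (intro mult_right_mono) auto
    also have "\<dots> = p * B - p" by (cases B) (auto simp: algebra_simps)
    also have "\<dots> \<le> p * B - B" using Bp by simp
    also have "\<dots> = (p - 1) * B" by (simp add: diff_mult_distrib)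
    finally show ?thesis .
  qed
  have u1: "(j + 1) * p \<le> u * B" unfolding u_def by (rule LeastI, rule up)
  have ult: "u \<le> p - 1" unfolding u_def by (rule Least_le, rule up)
  have u0: "0 < u" using u1 p0 by (cases u) auto
  have u2: "(u - 1) * B < (j + 1) * p"
    using not_less_Least[of "u - 1" "\<lambda>t. (j + 1) * p \<le> t * B"] u0 unfolding u_def[symmetric] by simp
  have su: "s < u"
  proof (rule ccontr)
    assume "\<not> s < u"
    then have "u * B \<le> s * B" by simp
    then show False using u1 sB by linarith
  qed
  have uC: "(j + 2) * p \<le> u * C"
  proof -
    have "s * A \<le> u * A" using su by simp
    then have "p \<le> u * A" using s1 by linarith
    then have "1 \<le> (u * A) div p" using p0 by (simp add: Suc_le_eq div_greater_zero_iff)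
    moreover have "j + 1 \<le> (u * B) div p" using u1 p0 less_eq_div_iff_mult_less_eq by blast
    ultimately have "j + 2 \<le> (u * C) div p" using eq[of u] ult p0 by linarith
    then show ?thesis using p0 less_eq_div_iff_mult_less_eq by blast
  qed
  have vC: "(v - 1) * C < j * p"
  proof -
    have "(v - 1) * A \<le> (s - 1) * A" using vs by (intro mult_le_mono1) linarith
    then have "(v - 1) * A < p" using s2 by linarith
    then have "((v - 1) * A) div p = 0" by (rule div_less)
    moreover have "((v - 1) * B) div p < j" using v2 p0 by (simp add: div_less_iff_less_mult)
    ultimately have "((v - 1) * C) div p < j" using eq[of "v - 1"] vs sp by simp
    then show ?thesis using p0 by (simp add: div_less_iff_less_mult)
  qed
  have "(u - 1 - v) * B < p"
  proof -
    have "(u - 1 - v) * B = (u - 1) * B - v * B" by (simp add: diff_mult_distrib)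
    then show ?thesis using u2 v1 p0 by (simp add: algebra_simps)
  qed
  then have "u - 1 - v < t"
    using tB by (meson le_less_trans less_le_trans mult_le_mono1 not_le)
  then have "u \<le> v + t" by linarith
  then have "u \<le> (v - 1) + (t - 1) + 2" using v0 t0 by linarith
  then have "u * C \<le> ((v - 1) + (t - 1) + 2) * C" by (rule mult_le_mono1)
  also have "\<dots> = (v - 1) * C + (t - 1) * C + 2 * C" by (simp add: algebra_simps)
  also have "\<dots> < j * p + p + p" using vC t2 Cp by linarith
  finally show False using uC by (simp add: algebra_simps)
qed
text \<open>
  With \<open>C = p - c\<close> the hypothesis says that the floor sequences of \<open>a\<close> and \<open>b\<close> add up to that of \<open>C\<close>, since
  the sequences of \<open>c\<close> and \<open>p - c\<close> jump at complementary places.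
\<close>

lemma floor_sums_unit_if_large:
  fixes a b c p :: nat
  assumes p: "prime p" and pos: "0 < a" "0 < b" "0 < c" and lt: "a < p" "b < p" "c < p"
    and sum: "a + b + c = p + 1"
    and eq: "\<And>k. 0 < k \<Longrightarrow> k < p \<Longrightarrow> (k * a) div p + (k * b) div p + (k * c) div p = k - 1"
    and c: "p \<le> 2 * c"
  shows "a = 1 \<or> b = 1"
proof (rule ccontr)
  assume n1: "\<not> (a = 1 \<or> b = 1)"
  have p0: "0 < p" using p by (simp add: prime_gt_0_nat)
  define C where "C = p - c"
  have C: "a + b = C + 1" using sum lt C_def by linarith
  have "p \<noteq> 2" using pos lt n1 by linarith
  then have odd: "odd p" using p primes_dvd_imp_eq two_is_prime_nat by blast
  have Cp: "2 * C < p"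
  proof -
    have "2 * C \<le> p" using c C_def by linarith
    moreover have "2 * C \<noteq> p" using odd by auto
    ultimately show ?thesis by simp
  qed
  have fl: "(k * a) div p + (k * b) div p = (k * C) div p" if "k < p" for k
  proof (cases "k = 0")
    case False
    have nd: "\<not> p dvd k * c"
      using p False that lt(3) pos(3) by (auto simp: prime_dvd_mult_iff dest: dvd_imp_le)
    have "(k * C) div p + (k * c) div p + 1 = k"
    proof -
      define q where "q = (k * c) div p"
      define r where "r = (k * c) mod p"
      have qr: "k * c = q * p + r" unfolding q_def r_def by simp
      have r: "0 < r" "r < p" using nd p0 unfolding r_def by (auto simp: dvd_eq_mod_eq_0)
      have "k * c \<le> k * p" using lt(3) by simp
      then have "q * p < k * p" using qr r by linarith
      then have qk: "q < k" by simp
      have "k * C = k * p - k * c" by (simp add: C_def diff_mult_distrib2)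
      also have "\<dots> = (k - q - 1) * p + (p - r)"
      proof -
        obtain i where "k = q + i + 1" using qk less_iff_Suc_add by auto
        then show ?thesis using qr r by (simp add: algebra_simps)
      qed
      finally have kC: "k * C = (k - q - 1) * p + (p - r)" .
      have "(x * p + (p - r)) div p = x" for x
        using r by (intro div_nat_eqI) (auto simp: algebra_simps)
      then have "(k * C) div p = k - q - 1" unfolding kC .
      then show ?thesis using qk unfolding q_def by simp
    qed
    moreover have "(k * a) div p + (k * b) div p + (k * c) div p = k - 1"
      using eq that False by simp
    ultimately show ?thesis by linarith
  qed simp
  show False
  proof (cases "a \<le> b")
    case True
    show False
      by (rule floor_sums_no_merge[OF p _ True C Cp fl]) (use n1 pos in auto)
  next
    case False
    show False
      by (rule floor_sums_no_merge[OF p, of b a C]) (use False n1 pos C Cp fl in \<open>auto simp: add.commute\<close>)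
  qed
qed

lemma residue_triple_unit:
  fixes a b c p :: nat
  assumes p: "prime p" and pos: "0 < a" "0 < b" "0 < c" and lt: "a < p" "b < p" "c < p"
    and eq: "\<And>k. 0 < k \<Longrightarrow> k < p \<Longrightarrow> (k * a) mod p + (k * b) mod p + (k * c) mod p = p + k"
  shows "a = 1 \<or> b = 1 \<or> c = 1"
proof -
  have p2: "2 \<le> p" using p by (rule prime_ge_2_nat)
  have sum: "a + b + c = p + 1" using eq[of 1] p2 lt by simp
  have fl: "(k * a) div p + (k * b) div p + (k * c) div p = k - 1" if k: "0 < k" "k < p" for k
  proof -
    have "((k * a) div p + (k * b) div p + (k * c) div p) * p
        + ((k * a) mod p + (k * b) mod p + (k * c) mod p) = k * (a + b + c)"
      using div_mult_mod_eq[of "k * a" p] div_mult_mod_eq[of "k * b" p] div_mult_mod_eq[of "k * c" p]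
      by (simp add: algebra_simps)
    also have "\<dots> = (k - 1) * p + (p + k)" using k sum by (cases k) (auto simp: algebra_simps)
    finally have "((k * a) div p + (k * b) div p + (k * c) div p) * p = (k - 1) * p"
      using eq[OF k] by simp
    then show ?thesis using p2 by simp
  qed
  \<comment> \<open>the sum of floors is 1 at \<open>k = 2\<close>, which makes one of the three numbers at least \<open>p / 2\<close>\<close>
  show ?thesis
  proof (cases "p = 2")
    case True
    then show ?thesis using pos lt by linarith
  next
    case False
    then have "(2 * a) div p + (2 * b) div p + (2 * c) div p = 1" using fl[of 2] p2 by simp
    then have "p \<le> 2 * a \<or> p \<le> 2 * b \<or> p \<le> 2 * c"
      by (metis add_0 div_less linorder_not_le zero_neq_one)
    then consider "p \<le> 2 * a" | "p \<le> 2 * b" | "p \<le> 2 * c" by blast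
    then show ?thesis
    proof cases
      case 1
      show ?thesis using floor_sums_unit_if_large[OF p pos(2,3,1) lt(2,3,1) _ _ 1] sum fl
        by (auto simp: ac_simps)
    next
      case 2
      show ?thesis using floor_sums_unit_if_large[OF p pos(1,3,2) lt(1,3,2) _ _ 2] sum fl
        by (auto simp: ac_simps)
    next
      case 3
      show ?thesis using floor_sums_unit_if_large[OF p pos lt _ _ 3] sum fl by auto
    qed
  qed
qed

text \<open>
  Multiplying by the inverse \<open>j\<close> of \<open>n1\<close> modulo \<open>p\<close> and negating the other three numbers leads to
  the preceding lemma; its conclusion \<open>- j * n = 1\<close> modulo \<open>p\<close> means \<open>n1 + n = 0\<close>.
\<close>

lemma residue_sums_pairing:
  fixes n1 n2 n3 n4 :: int and p :: nat
  assumes p: "prime p"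
    and nd: "\<not> int p dvd n1" "\<not> int p dvd n2" "\<not> int p dvd n3" "\<not> int p dvd n4"
    and eq: "\<And>k. 0 < k \<Longrightarrow> k < int p \<Longrightarrow>
      (k * n1) mod int p + (k * n2) mod int p + (k * n3) mod int p + (k * n4) mod int p = 2 * int p"
  shows "int p dvd n1 + n2 \<or> int p dvd n1 + n3 \<or> int p dvd n1 + n4"
proof -
  have p0: "0 < int p" and p1: "1 < int p" using p prime_gt_1_nat[OF p] by (auto simp: prime_gt_0_nat)
  have pi: "prime (int p)" using p by simp
  obtain j i where ji: "j * n1 + i * int p = 1"
    using bezout_int[of n1 "int p"] prime_imp_coprime[OF pi nd(1)] by (auto simp: coprime_iff_gcd_eq_1 gcd.commute)
  have jn1: "j * n1 mod int p = 1"
    using ji p1 by (metis add.commute mod_mult_self2 mod_pos_pos_trivial zero_le_one mult.commute)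
  have ndj: "\<not> int p dvd j"
    using jn1 by (metis dvd_imp_mod_0 dvd_mult2 zero_neq_one)
  define m where "m n = nat ((- (j * n)) mod int p)" for n
  have mi: "int (m n) = (- (j * n)) mod int p" for n unfolding m_def using p0 by simp
  have mpos: "0 < m n" "m n < p" if "\<not> int p dvd n" for n
  proof -
    have "\<not> int p dvd - (j * n)" using that ndj pi by (simp add: prime_dvd_mult_iff)
    then have "(- (j * n)) mod int p \<noteq> 0" by (simp add: dvd_eq_mod_eq_0)
    then show "0 < m n" using mi[of n] by (metis gr0I of_nat_0)
    show "m n < p" using mi[of n] p0 by (metis of_nat_less_iff pos_mod_bound)
  qed
  have one: "int p dvd n1 + n" if "m n = 1" for n
  proof -
    have "(- (j * n)) mod int p = 1" using mi[of n] that by simp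
    then have "(j * n1 - (- (j * n))) mod int p = 0"
      using jn1 by (metis cancel_comm_monoid_add_class.diff_cancel mod_0 mod_diff_eq)
    then have "int p dvd j * (n1 + n)" by (simp add: algebra_simps dvd_eq_mod_eq_0)
    then show ?thesis using ndj pi by (simp add: prime_dvd_mult_iff)
  qed
  have "m n2 = 1 \<or> m n3 = 1 \<or> m n4 = 1"
  proof (rule residue_triple_unit[OF p])
    fix k :: nat assume k: "0 < k" "k < p"
    have ndk: "\<not> int p dvd int k" using k by (auto dest: zdvd_imp_le)
    define l where "l = (int k * j) mod int p"
    have "\<not> int p dvd int k * j" using ndk ndj pi by (simp add: prime_dvd_mult_iff)
    then have "l \<noteq> 0" unfolding l_def by (simp add: dvd_eq_mod_eq_0)
    moreover have "0 \<le> l" "l < int p" unfolding l_def using p0 by auto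
    ultimately have l: "0 < l" "l < int p" by linarith+
    have 1: "(l * n1) mod int p = int k"
    proof -
      have "(l * n1) mod int p = (int k * (j * n1 mod int p)) mod int p"
        unfolding l_def by (simp add: mod_mult_left_eq mod_mult_right_eq mult.assoc)
      then show ?thesis using jn1 k by simp
    qed
    have 2: "(l * n) mod int p = int p - int ((k * m n) mod p)" if n: "\<not> int p dvd n" for n
    proof -
      have e: "(l * n) mod int p = (int k * (j * n)) mod int p"
        unfolding l_def by (simp add: mod_mult_left_eq mult.assoc)
      have "int ((k * m n) mod p) = (int k * ((- (j * n)) mod int p)) mod int p"
        by (simp add: zmod_int mi)
      also have "\<dots> = (- (int k * (j * n))) mod int p"
        by (simp add: mod_mult_right_eq)
      also have "\<dots> = int p - (int k * (j * n)) mod int p"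
      proof -
        have "\<not> int p dvd int k * (j * n)" using ndk ndj n pi by (simp add: prime_dvd_mult_iff)
        then show ?thesis by (simp add: zmod_zminus1_eq_if dvd_eq_mod_eq_0)
      qed
      finally show ?thesis using e by simp
    qed
    have "int ((k * m n2) mod p + (k * m n3) mod p + (k * m n4) mod p) = int (p + k)"
      using eq[OF l] 1 2[OF nd(2)] 2[OF nd(3)] 2[OF nd(4)] by simp
    then show "(k * m n2) mod p + (k * m n3) mod p + (k * m n4) mod p = p + k"
      by (simp only: of_nat_eq_iff)
  qed (use mpos nd in auto)
  then show ?thesis using one by blast
qed

section \<open>Four candidate points and the cube\<close>

text \<open>
  One coordinate of the vertices \<open>a, b, c, d\<close>, in the interval from -1 to 1. With
  \<open>y = x a + (1 - x) b + (1 - t) c + t d\<close> and \<open>z = a + b + c + d - y\<close>, the four numbers are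
  \<open>y1 = y - a\<close>, \<open>y2 = y - b\<close>, \<open>y4 = y - d\<close> and \<open>z3 = z - c\<close>. For each pair a suitable
  combination with positive weights is at most the sum of the weights.
\<close>

lemma cube_coordinate_pos:
  fixes a b c d x t :: real
  assumes a: "\<bar>a\<bar> \<le> 1" and b: "\<bar>b\<bar> \<le> 1" and c: "\<bar>c\<bar> \<le> 1" and d: "\<bar>d\<bar> \<le> 1"
    and t: "1 - t \<le> x" "x \<le> t" "t < 1"
  defines "y1 \<equiv> (x - 1) * a + (1 - x) * b + (1 - t) * c + t * d"
    and "y2 \<equiv> x * a - x * b + (1 - t) * c + t * d"
    and "y4 \<equiv> x * a + (1 - x) * b + (1 - t) * c + (t - 1) * d"
    and "z3 \<equiv> (1 - x) * a + x * b + (t - 1) * c + (1 - t) * d"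
  shows "y1 \<le> 1 \<or> y2 \<le> 1" "y1 \<le> 1 \<or> y4 \<le> 1" "y2 \<le> 1 \<or> y4 \<le> 1"
    "y1 \<le> 1 \<or> z3 \<le> 1" "y2 \<le> 1 \<or> z3 \<le> 1" "y4 \<le> 1 \<or> z3 \<le> 1"
    "y1 \<le> 1 \<or> - z3 \<le> 1" "y2 \<le> 1 \<or> - z3 \<le> 1" "y4 \<le> 1 \<or> - z3 \<le> 1"
proof -
  have x: "0 < x" "0 < 1 - x" "0 < 1 - t" "0 < t" using t by linarith+
  have bd: "l * e \<le> l" "- l \<le> l * e" if "0 \<le> l" "\<bar>e\<bar> \<le> 1" for l e :: real
    using that mult_left_mono[of e 1 l] mult_left_mono[of "-1" e l] by auto
  \<comment> \<open>a nonnegative combination of two numbers above 1 exceeds the sum of its weights\<close>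
  have comb: "p \<le> 1 \<or> q \<le> 1" if "0 < l" "0 < m" "l * p + m * q \<le> l + m" for l m p q :: real
    using that mult_strict_left_mono[of 1 p l] mult_strict_left_mono[of 1 q m] by fastforce
  show "y1 \<le> 1 \<or> y2 \<le> 1"
  proof (rule comb[OF x(1,2)])
    have "x * y1 + (1 - x) * y2 = (1 - t) * c + t * d"
      unfolding y1_def y2_def by algebra
    then show "x * y1 + (1 - x) * y2 \<le> x + (1 - x)" using bd(1)[of "1 - t" c] bd(1)[of t d] x c d by linarith
  qed
  show "y1 \<le> 1 \<or> y4 \<le> 1"
  proof (rule comb[OF x(1,4)])
    have "x * y1 + t * y4 = (x + t - 1) * (x * a) + (x + t - 1) * ((1 - x) * b) + (x + t - 1) * ((1 - t) * c)
        + (x + t - 1) * (t * d) + (1 - x) * b + (1 - t) * c"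
      unfolding y1_def y4_def by algebra
    also have "\<dots> \<le> (x + t - 1) * x + (x + t - 1) * (1 - x) + (x + t - 1) * (1 - t)
        + (x + t - 1) * t + (1 - x) + (1 - t)"
      using t x a b c d by (intro add_mono mult_left_mono bd(1)) auto
    also have "\<dots> = x + t" by algebra
    finally show "x * y1 + t * y4 \<le> x + t" .
  qed
  show "y2 \<le> 1 \<or> y4 \<le> 1"
  proof (rule comb[OF x(2,4)])
    have "(1 - x) * y2 + t * y4 = (t - x) * (x * a) + (t - x) * ((1 - x) * b) + (t - x) * ((1 - t) * c)
        + (t - x) * (t * d) + x * a + (1 - t) * c"
      unfolding y2_def y4_def by algebra
    also have "\<dots> \<le> (t - x) * x + (t - x) * (1 - x) + (t - x) * (1 - t)
        + (t - x) * t + x + (1 - t)"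
      using t x a b c d by (intro add_mono mult_left_mono bd(1)) auto
    also have "\<dots> = (1 - x) + t" by algebra
    finally show "(1 - x) * y2 + t * y4 \<le> (1 - x) + t" .
  qed
  have "y1 + z3 = b + d" "y2 + z3 = a + d" "y4 + z3 = a + b"
    unfolding y1_def y2_def y4_def z3_def by algebra+
  then show "y1 \<le> 1 \<or> z3 \<le> 1" "y2 \<le> 1 \<or> z3 \<le> 1" "y4 \<le> 1 \<or> z3 \<le> 1"
    using a b d by linarith+
  show "y1 \<le> 1 \<or> - z3 \<le> 1"
  proof (rule comb[OF x(1,2)])
    have "x * y1 + (1 - x) * - z3 = (1 - x) * (- a) + (1 - t) * c + (x + t - 1) * d"
      unfolding y1_def z3_def by algebra
    also have "\<dots> \<le> (1 - x) + (1 - t) + (x + t - 1)"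
      using t x a c d by (intro add_mono bd(1)) auto
    finally show "x * y1 + (1 - x) * - z3 \<le> x + (1 - x)" by simp
  qed
  show "y2 \<le> 1 \<or> - z3 \<le> 1"
  proof (rule comb[OF x(2,1)])
    have "(1 - x) * y2 + x * - z3 = x * (- b) + (1 - t) * c + (t - x) * d"
      unfolding y2_def z3_def by algebra
    also have "\<dots> \<le> x + (1 - t) + (t - x)"
      using t x b c d by (intro add_mono bd(1)) auto
    finally show "(1 - x) * y2 + x * - z3 \<le> (1 - x) + x" by simp
  qed
  show "y4 \<le> 1 \<or> - z3 \<le> 1"
  proof -
    have "y4 - z3 = (2 * x - 1) * (a - b) + (1 - t) * c + (1 - t) * c - (1 - t) * d - (1 - t) * d"
      unfolding y4_def z3_def by algebra
    moreover have "(2 * x - 1) * (a - b) \<le> 2 * (2 * t - 1)"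
    proof -
      have "(2 * x - 1) * (a - b) \<le> \<bar>2 * x - 1\<bar> * \<bar>a - b\<bar>" by (metis abs_ge_self abs_mult)
      also have "\<dots> \<le> (2 * t - 1) * 2" using t a b by (intro mult_mono) auto
      finally show ?thesis by simp
    qed
    moreover have "(1 - t) * c \<le> 1 - t" "- (1 - t) \<le> (1 - t) * d"
      using x c d by (auto intro!: bd(1) bd(2)[of "1 - t", simplified])
    moreover have "2 * (2 * t - 1) + (1 - t) + (1 - t) + (1 - t) + (1 - t) = 2" by simp
    moreover have "p + q + q - r - r \<le> m + l + l + l + l" if "p \<le> m" "q \<le> l" "- l \<le> r"
      for p q r m l :: real using that by linarith
    ultimately have "y4 - z3 \<le> 2" by metis
    then show ?thesis by linarith
  qed
qed

text \<open>
  In each coordinate at most one of the four candidates leaves the unit interval. The vertices are moved to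
  the interval from -1 to 1, and their negatives supply the bounds on the other side.
\<close>

lemma cube_coordinate:
  fixes a b c d x t :: real
  assumes "a \<in> {0..1}" "b \<in> {0..1}" "c \<in> {0..1}" "d \<in> {0..1}"
    and t: "1 - t \<le> x" "x \<le> t" "t < 1"
  defines "y1 \<equiv> (x - 1) * a + (1 - x) * b + (1 - t) * c + t * d"
    and "y2 \<equiv> x * a - x * b + (1 - t) * c + t * d"
    and "y4 \<equiv> x * a + (1 - x) * b + (1 - t) * c + (t - 1) * d"
    and "z3 \<equiv> (1 - x) * a + x * b + (t - 1) * c + (1 - t) * d"
  shows "y1 \<in> {0..1} \<or> y2 \<in> {0..1}" "y1 \<in> {0..1} \<or> y4 \<in> {0..1}" "y2 \<in> {0..1} \<or> y4 \<in> {0..1}"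
    "y1 \<in> {0..1} \<or> z3 \<in> {0..1}" "y2 \<in> {0..1} \<or> z3 \<in> {0..1}" "y4 \<in> {0..1} \<or> z3 \<in> {0..1}"
proof -
  have b: "\<bar>2 * a - 1\<bar> \<le> 1" "\<bar>2 * b - 1\<bar> \<le> 1" "\<bar>2 * c - 1\<bar> \<le> 1" "\<bar>2 * d - 1\<bar> \<le> 1"
    using assms(1-4) by (auto simp: abs_le_iff)
  then have b': "\<bar>1 - 2 * a\<bar> \<le> 1" "\<bar>1 - 2 * b\<bar> \<le> 1" "\<bar>1 - 2 * c\<bar> \<le> 1" "\<bar>1 - 2 * d\<bar> \<le> 1"
    by (simp_all add: abs_minus_commute)
  have e: "(x - 1) * (2 * a - 1) + (1 - x) * (2 * b - 1) + (1 - t) * (2 * c - 1) + t * (2 * d - 1) = 2 * y1 - 1"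
    "x * (2 * a - 1) - x * (2 * b - 1) + (1 - t) * (2 * c - 1) + t * (2 * d - 1) = 2 * y2 - 1"
    "x * (2 * a - 1) + (1 - x) * (2 * b - 1) + (1 - t) * (2 * c - 1) + (t - 1) * (2 * d - 1) = 2 * y4 - 1"
    "(1 - x) * (2 * a - 1) + x * (2 * b - 1) + (t - 1) * (2 * c - 1) + (1 - t) * (2 * d - 1) = 2 * z3 - 1"
    "(x - 1) * (1 - 2 * a) + (1 - x) * (1 - 2 * b) + (1 - t) * (1 - 2 * c) + t * (1 - 2 * d) = 1 - 2 * y1"
    "x * (1 - 2 * a) - x * (1 - 2 * b) + (1 - t) * (1 - 2 * c) + t * (1 - 2 * d) = 1 - 2 * y2"
    "x * (1 - 2 * a) + (1 - x) * (1 - 2 * b) + (1 - t) * (1 - 2 * c) + (t - 1) * (1 - 2 * d) = 1 - 2 * y4"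
    "(1 - x) * (1 - 2 * a) + x * (1 - 2 * b) + (t - 1) * (1 - 2 * c) + (1 - t) * (1 - 2 * d) = 1 - 2 * z3"
    unfolding y1_def y2_def y4_def z3_def by algebra+
  note P = cube_coordinate_pos[OF b t, unfolded e] and N = cube_coordinate_pos[OF b' t, unfolded e]
  \<comment> \<open>the first three points are pairwise differences of vertices, so two of them cannot leave on opposite sides\<close>
  have "y2 - y1 = a - b" "y4 - y1 = a - d" "y4 - y2 = b - d"
    unfolding y1_def y2_def y4_def by algebra+
  then have D: "\<bar>y2 - y1\<bar> \<le> 1" "\<bar>y4 - y1\<bar> \<le> 1" "\<bar>y4 - y2\<bar> \<le> 1"
    using assms(1-4) by auto
  show "y1 \<in> {0..1} \<or> y2 \<in> {0..1}" using P(1) N(1) D unfolding atLeastAtMost_iff by linarith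
  show "y1 \<in> {0..1} \<or> y4 \<in> {0..1}" using P(2) N(2) D unfolding atLeastAtMost_iff by linarith
  show "y2 \<in> {0..1} \<or> y4 \<in> {0..1}" using P(3) N(3) D unfolding atLeastAtMost_iff by linarith
  show "y1 \<in> {0..1} \<or> z3 \<in> {0..1}" using P(4,7) N(4,7) unfolding atLeastAtMost_iff by linarith
  show "y2 \<in> {0..1} \<or> z3 \<in> {0..1}" using P(5,8) N(5,8) unfolding atLeastAtMost_iff by linarith
  show "y4 \<in> {0..1} \<or> z3 \<in> {0..1}" using P(6,9) N(6,9) unfolding atLeastAtMost_iff by linarith
qed

text \<open>Three coordinates cannot exclude four candidates, as each of them excludes at most one.\<close>

lemma cube_candidates:
  fixes a b c d :: "real ^ 3" and x t :: real
  assumes abcd: "a \<in> cbox 0 1" "b \<in> cbox 0 1" "c \<in> cbox 0 1" "d \<in> cbox 0 1"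
    and t: "1 - t \<le> x" "x \<le> t" "t < 1"
  defines "y1 \<equiv> (x - 1) *\<^sub>R a + (1 - x) *\<^sub>R b + (1 - t) *\<^sub>R c + t *\<^sub>R d"
    and "y2 \<equiv> x *\<^sub>R a - x *\<^sub>R b + (1 - t) *\<^sub>R c + t *\<^sub>R d"
    and "y4 \<equiv> x *\<^sub>R a + (1 - x) *\<^sub>R b + (1 - t) *\<^sub>R c + (t - 1) *\<^sub>R d"
    and "z3 \<equiv> (1 - x) *\<^sub>R a + x *\<^sub>R b + (t - 1) *\<^sub>R c + (1 - t) *\<^sub>R d"
  shows "y1 \<in> cbox 0 1 \<or> y2 \<in> cbox 0 1 \<or> y4 \<in> cbox 0 1 \<or> z3 \<in> cbox 0 1"
proof -
  have cb: "v \<in> cbox 0 1 \<longleftrightarrow> (\<forall>i. v $ i \<in> {0..1})" for v :: "real ^ 3"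
    by (auto simp: mem_box_cart)
  have "y1 $ i \<in> {0..1} \<or> y2 $ i \<in> {0..1}" "y1 $ i \<in> {0..1} \<or> y4 $ i \<in> {0..1}"
    "y2 $ i \<in> {0..1} \<or> y4 $ i \<in> {0..1}" "y1 $ i \<in> {0..1} \<or> z3 $ i \<in> {0..1}"
    "y2 $ i \<in> {0..1} \<or> z3 $ i \<in> {0..1}" "y4 $ i \<in> {0..1} \<or> z3 $ i \<in> {0..1}" for i
    using cube_coordinate[of "a $ i" "b $ i" "c $ i" "d $ i" t x] abcd t
    unfolding cb y1_def y2_def y4_def z3_def by simp_all
  then show ?thesis unfolding cb forall_3 by metis
qed

section \<open>Normalized volume of lattice tetrahedra\<close>

unbundle cross3_syntax

text \<open>
  The signed normalized volume of the tetrahedron \<open>abcd\<close>, that is, the determinant of its edge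
  vectors at \<open>a\<close>. It is six times the Euclidean volume up to sign, so that 1 and -1 are the unimodular values.
\<close>

definition tvol :: "real^3 \<Rightarrow> real^3 \<Rightarrow> real^3 \<Rightarrow> real^3 \<Rightarrow> real" where
  "tvol a b c d = (b - a) \<bullet> ((c - a) \<times> (d - a))"

lemma tvol_swap: "tvol b a c d = - tvol a b c d"
  and tvol_rotate: "tvol b c d a = - tvol a b c d"
  unfolding tvol_def by (simp_all add: cross3_def inner_vec_def sum_3) algebra+

lemma tvol_replace:
  assumes "e = \<alpha> *\<^sub>R a + \<beta> *\<^sub>R b + \<gamma> *\<^sub>R c + \<delta> *\<^sub>R d" "\<alpha> + \<beta> + \<gamma> + \<delta> = 1"
  shows "tvol e b c d = \<alpha> * tvol a b c d"
proof -
  have a: "\<alpha> = 1 - \<beta> - \<gamma> - \<delta>" using assms(2) by linarith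
  show ?thesis unfolding tvol_def assms(1) a
    by (simp add: cross3_def inner_vec_def sum_3) algebra
qed

text \<open>The Cramer rule, with the coordinates of \<open>z\<close> written as triple products.\<close>

lemma cross_coords:
  fixes z u v w :: "real ^ 3"
  shows "(u \<bullet> (v \<times> w)) *\<^sub>R z = (z \<bullet> (v \<times> w)) *\<^sub>R u + (z \<bullet> (w \<times> u)) *\<^sub>R v + (z \<bullet> (u \<times> v)) *\<^sub>R w"
  by (simp add: vec_eq_iff forall_3 cross3_def inner_vec_def sum_3) algebra

lemma int_points_closed:
  assumes "x \<in> int_points" "y \<in> int_points"
  shows "x + y \<in> int_points" "x - y \<in> int_points" "of_int n *\<^sub>R x \<in> int_points" "x \<times> y \<in> int_points"
    "x \<bullet> y \<in> \<int>"
  using assms by (auto simp: int_points_def cross3_def forall_3 inner_vec_def sum_3)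

lemma tvol_Ints:
  "a \<in> int_points \<Longrightarrow> b \<in> int_points \<Longrightarrow> c \<in> int_points \<Longrightarrow> d \<in> int_points \<Longrightarrow> tvol a b c d \<in> \<int>"
  unfolding tvol_def by (intro int_points_closed)

text \<open>
  Unless the volume is 1 or -1, the edge vectors do not generate all lattice points: their dual basis
  would be integral, with determinant the inverse of the volume.
\<close>

lemma tvol_Ints_nonunit:
  assumes abcd: "a \<in> int_points" "b \<in> int_points" "c \<in> int_points" "d \<in> int_points"
    and vol: "tvol a b c d \<noteq> 0" "\<bar>tvol a b c d\<bar> \<noteq> 1"
  obtains z \<beta> \<gamma> \<delta> where "z \<in> int_points" "z = \<beta> *\<^sub>R (b - a) + \<gamma> *\<^sub>R (c - a) + \<delta> *\<^sub>R (d - a)"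
    "tvol a b c d * \<beta> \<in> \<int>" "tvol a b c d * \<gamma> \<in> \<int>" "tvol a b c d * \<delta> \<in> \<int>"
    "\<not> (\<beta> \<in> \<int> \<and> \<gamma> \<in> \<int> \<and> \<delta> \<in> \<int>)"
proof -
  define u v w where "u = b - a" "v = c - a" "w = d - a"
  define D where "D = u \<bullet> (v \<times> w)"
  have D: "tvol a b c d = D" unfolding tvol_def D_def u_v_w_def ..
  have uvw: "u \<in> int_points" "v \<in> int_points" "w \<in> int_points"
    unfolding u_v_w_def using abcd by (auto intro: int_points_closed)
  have "\<exists>z\<in>int_points. \<not> (z \<bullet> (v \<times> w) / D \<in> \<int> \<and> z \<bullet> (w \<times> u) / D \<in> \<int> \<and> z \<bullet> (u \<times> v) / D \<in> \<int>)"
  proof (rule ccontr)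
    assume "\<not> ?thesis"
    then have all: "z \<bullet> (v \<times> w) / D \<in> \<int> \<and> z \<bullet> (w \<times> u) / D \<in> \<int> \<and> z \<bullet> (u \<times> v) / D \<in> \<int>"
      if "z \<in> int_points" for z
      using that by blast
    have ax: "axis i 1 \<in> int_points" for i :: 3
      unfolding int_points_def axis_def by simp
    \<comment> \<open>the dual basis of the three edge vectors would be integral\<close>
    have "(1 / D) *\<^sub>R (v \<times> w) \<in> int_points" "(1 / D) *\<^sub>R (w \<times> u) \<in> int_points"
        "(1 / D) *\<^sub>R (u \<times> v) \<in> int_points"
      unfolding int_points_def using all[OF ax] by (auto simp: inner_axis' )
    then have "((1 / D) *\<^sub>R (v \<times> w)) \<bullet> (((1 / D) *\<^sub>R (w \<times> u)) \<times> ((1 / D) *\<^sub>R (u \<times> v))) \<in> \<int>"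
      by (intro int_points_closed)
    moreover have "(v \<times> w) \<bullet> ((w \<times> u) \<times> (u \<times> v)) = D * D"
      unfolding D_def by (simp add: cross3_def inner_vec_def sum_3) algebra
    ultimately have "1 / D \<in> \<int>"
      using vol by (simp add: cross_mult_left cross_mult_right D field_simps)
    moreover have "D \<in> \<int>" using tvol_Ints[OF abcd] D by simp
    ultimately obtain m n :: int where mn: "1 / D = m" "D = n" by (auto elim!: Ints_cases)
    have "real_of_int (m * n) = 1" using mn vol D by (simp add: field_simps)
    then have "m * n = 1" by linarith
    then have "\<bar>n\<bar> = 1" by (metis abs_mult abs_1 abs_zmult_eq_1 mult.commute)
    then show False using vol D mn by simp
  qed
  then obtain z where z: "z \<in> int_points"
    "\<not> (z \<bullet> (v \<times> w) / D \<in> \<int> \<and> z \<bullet> (w \<times> u) / D \<in> \<int> \<and> z \<bullet> (u \<times> v) / D \<in> \<int>)" by blast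
  show thesis
  proof (rule that[OF z(1) _ _ _ _ z(2)])
    have D0: "D \<noteq> 0" using vol D by simp
    have "z = (1 / D) *\<^sub>R (D *\<^sub>R z)" using D0 by simp
    also have "\<dots> = (z \<bullet> (v \<times> w) / D) *\<^sub>R u + (z \<bullet> (w \<times> u) / D) *\<^sub>R v + (z \<bullet> (u \<times> v) / D) *\<^sub>R w"
      unfolding cross_coords[of u v w z, folded D_def] by (simp add: scaleR_add_right)
    finally show "z = (z \<bullet> (v \<times> w) / D) *\<^sub>R (b - a) + (z \<bullet> (w \<times> u) / D) *\<^sub>R (c - a) + (z \<bullet> (u \<times> v) / D) *\<^sub>R (d - a)"
      unfolding u_v_w_def .
    show "tvol a b c d * (z \<bullet> (v \<times> w) / D) \<in> \<int>" "tvol a b c d * (z \<bullet> (w \<times> u) / D) \<in> \<int>"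
      "tvol a b c d * (z \<bullet> (u \<times> v) / D) \<in> \<int>"
      using D0 uvw z(1) by (simp_all add: D int_points_closed)
  qed
qed

lemma unimodular_hull:
  assumes abcd: "a \<in> int_points" "b \<in> int_points" "c \<in> int_points" "d \<in> int_points"
    and vol: "\<bar>tvol a b c d\<bar> = 1"
  shows "unimodular_tetrahedron (convex hull {a, b, c, d})"
proof -
  define u v w where "u = b - a" "v = c - a" "w = d - a"
  define D where "D = u \<bullet> (v \<times> w)"
  have D: "tvol a b c d = D" unfolding tvol_def D_def u_v_w_def ..
  have D1: "D = 1 \<or> D = -1" using vol D by linarith
  have uvw: "u \<in> int_points" "v \<in> int_points" "w \<in> int_points"
    unfolding u_v_w_def using abcd by (auto intro: int_points_closed)
  have coeff: "(x *\<^sub>R u + y *\<^sub>R v + z *\<^sub>R w) \<bullet> (v \<times> w) = x * D"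
    "(x *\<^sub>R u + y *\<^sub>R v + z *\<^sub>R w) \<bullet> (w \<times> u) = y * D"
    "(x *\<^sub>R u + y *\<^sub>R v + z *\<^sub>R w) \<bullet> (u \<times> v) = z * D" for x y z
    unfolding D_def by (simp_all add: cross3_def inner_vec_def sum_3) algebra+
  have ind0: "x = 0 \<and> y = 0 \<and> z = 0" if "x *\<^sub>R u + y *\<^sub>R v + z *\<^sub>R w = 0" for x y z
    using coeff[of x y z] D1 unfolding that by auto
  have ne: "u \<noteq> v" "u \<noteq> w" "v \<noteq> w" "u \<noteq> 0" "v \<noteq> 0" "w \<noteq> 0"
    using ind0[of 1 "-1" 0] ind0[of 1 0 "-1"] ind0[of 0 1 "-1"] ind0[of 1 0 0] ind0[of 0 1 0] ind0[of 0 0 1]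
    by auto
  have dist: "a \<noteq> b" "a \<noteq> c" "a \<noteq> d" "b \<noteq> c" "b \<noteq> d" "c \<noteq> d"
    using ne unfolding u_v_w_def by auto
  have sum3: "(\<Sum>s\<in>{u,v,w}. f s) = f u + f v + f w" for f :: "real^3 \<Rightarrow> real^3"
    using ne by (simp add: add.assoc)
  have "independent {u, v, w}"
    unfolding dependent_finite[OF finite.insertI[OF finite.insertI[OF finite.insertI[OF finite.emptyI]]]]
    unfolding sum3 using ind0 by blast
  moreover have "(\<lambda>x. - a + x) ` {b, c, d} = {u, v, w}" unfolding u_v_w_def by auto
  ultimately have aff: "\<not> affine_dependent {a, b, c, d}"
    using affine_dependent_iff_dependent[of a "{b, c, d}"] dist by auto
  have sc: "int_scale n s = of_int n *\<^sub>R s" for n s by (rule int_scale_def)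
  have "int_module.independent {u, v, w}"
    unfolding int_module.dependent_finite[OF finite.insertI[OF finite.insertI[OF finite.insertI[OF finite.emptyI]]]]
    unfolding sum3 sc using ind0 by (metis insertE of_int_eq_0_iff singletonD)
  moreover have "int_module.span {u, v, w} = int_points"
  proof
    show "int_module.span {u, v, w} \<subseteq> int_points"
      unfolding int_module.span_finite[OF finite.insertI[OF finite.insertI[OF finite.insertI[OF finite.emptyI]]]]
      unfolding sum3 sc using uvw by (auto intro!: int_points_closed)
    show "int_points \<subseteq> int_module.span {u, v, w}"
    proof
      fix z assume z: "z \<in> int_points"
      have "D * (z \<bullet> (v \<times> w)) \<in> \<int>" "D * (z \<bullet> (w \<times> u)) \<in> \<int>" "D * (z \<bullet> (u \<times> v)) \<in> \<int>"
        unfolding D_def using z uvw by (auto intro!: Ints_mult int_points_closed)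
      then obtain i j k :: int where ijk: "D * (z \<bullet> (v \<times> w)) = i" "D * (z \<bullet> (w \<times> u)) = j" "D * (z \<bullet> (u \<times> v)) = k"
        by (auto elim!: Ints_cases)
      have "z = D *\<^sub>R (D *\<^sub>R z)" using D1 by auto
      also have "\<dots> = of_int i *\<^sub>R u + of_int j *\<^sub>R v + of_int k *\<^sub>R w"
        unfolding cross_coords[of u v w z, folded D_def] by (simp add: scaleR_add_right ijk)
      also have "\<dots> = int_scale i u + int_scale j v + int_scale k w" by (simp add: sc)
      also have "\<dots> \<in> int_module.span {u, v, w}"
        by (intro int_module.span_add int_module.span_scale int_module.span_base) auto
      finally show "z \<in> int_module.span {u, v, w}" .
    qed
  qed
  moreover have "(\<lambda>x. x - a) ` ({a, b, c, d} - {a}) = {u, v, w}"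
    unfolding u_v_w_def using dist by auto
  ultimately have "int_basis ((\<lambda>x. x - a) ` ({a, b, c, d} - {a}))"
    unfolding int_basis_def by simp
  moreover have "card {a, b, c, d} = 4" using dist by simp
  ultimately show ?thesis
    unfolding unimodular_tetrahedron_def using abcd aff by (intro exI[of _ "{a, b, c, d}"]) auto
qed

section \<open>Lattice points that reduce the volume\<close>

text \<open>
  The set \<open>P\<close> contains a lattice point whose barycentric coordinates relative to \<open>abcd\<close> are all
  less than 1; negative coordinates are permitted. Replacing a vertex of positive coordinate by
  this point makes the volume smaller.
\<close>

definition reducible :: "(real^3) set \<Rightarrow> real^3 \<Rightarrow> real^3 \<Rightarrow> real^3 \<Rightarrow> real^3 \<Rightarrow> bool" where
  "reducible P a b c d \<longleftrightarrow> (\<exists>\<alpha> \<beta> \<gamma> \<delta>. \<alpha> < 1 \<and> \<beta> < 1 \<and> \<gamma> < 1 \<and> \<delta> < 1 \<and> \<alpha> + \<beta> + \<gamma> + \<delta> = 1 \<and>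
     \<alpha> *\<^sub>R a + \<beta> *\<^sub>R b + \<gamma> *\<^sub>R c + \<delta> *\<^sub>R d \<in> int_points \<inter> P)"

lemma reducibleI:
  assumes "\<alpha> *\<^sub>R a + \<beta> *\<^sub>R b + \<gamma> *\<^sub>R c + \<delta> *\<^sub>R d \<in> int_points"
    "\<alpha> *\<^sub>R a + \<beta> *\<^sub>R b + \<gamma> *\<^sub>R c + \<delta> *\<^sub>R d \<in> P"
    "\<alpha> < 1" "\<beta> < 1" "\<gamma> < 1" "\<delta> < 1" "\<alpha> + \<beta> + \<gamma> + \<delta> = 1"
  shows "reducible P a b c d"
  unfolding reducible_def using assms by blast

lemma reducible_perm:
  assumes "reducible P a b c d"
  shows "reducible P b a c d" "reducible P a b d c" "reducible P c d a b" "reducible P a c b d" "reducible P a d c b"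
proof -
  obtain \<alpha> \<beta> \<gamma> \<delta> where *: "\<alpha> < 1" "\<beta> < 1" "\<gamma> < 1" "\<delta> < 1" "\<alpha> + \<beta> + \<gamma> + \<delta> = 1"
    "\<alpha> *\<^sub>R a + \<beta> *\<^sub>R b + \<gamma> *\<^sub>R c + \<delta> *\<^sub>R d \<in> int_points \<inter> P"
    using assms unfolding reducible_def by blast
  show "reducible P b a c d"
    by (rule reducibleI[of \<beta> b \<alpha> a \<gamma> c \<delta> d]) (use * in \<open>auto simp: ac_simps\<close>)
  show "reducible P a b d c"
    by (rule reducibleI[of \<alpha> a \<beta> b \<delta> d \<gamma> c]) (use * in \<open>auto simp: ac_simps\<close>)
  show "reducible P c d a b"
    by (rule reducibleI[of \<gamma> c \<delta> d \<alpha> a \<beta> b]) (use * in \<open>auto simp: ac_simps\<close>)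
  show "reducible P a c b d"
    by (rule reducibleI[of \<alpha> a \<gamma> c \<beta> b \<delta> d]) (use * in \<open>auto simp: ac_simps\<close>)
  show "reducible P a d c b"
    by (rule reducibleI[of \<alpha> a \<delta> d \<gamma> c \<beta> b]) (use * in \<open>auto simp: ac_simps\<close>)
qed

text \<open>
  If \<open>abcd\<close> is not unimodular, then the quotient of the lattice by the one generated by the edge
  vectors is a nontrivial finite group and so has an element of prime order \<open>p\<close>. The numbers \<open>n / p\<close> are
  barycentric coordinates of a representative.
\<close>

lemma prime_order_weights:
  assumes abcd: "a \<in> int_points" "b \<in> int_points" "c \<in> int_points" "d \<in> int_points"
    and vol: "tvol a b c d \<noteq> 0" "\<bar>tvol a b c d\<bar> \<noteq> 1"
  obtains p :: nat and n1 n2 n3 n4 :: int where "prime p" "n1 + n2 + n3 + n4 = int p"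
    "(of_int n1 / p) *\<^sub>R a + (of_int n2 / p) *\<^sub>R b + (of_int n3 / p) *\<^sub>R c + (of_int n4 / p) *\<^sub>R d \<in> int_points"
    "\<not> (int p dvd n1 \<and> int p dvd n2 \<and> int p dvd n3 \<and> int p dvd n4)"
proof -
  obtain z \<beta> \<gamma> \<delta> where z: "z \<in> int_points" "z = \<beta> *\<^sub>R (b - a) + \<gamma> *\<^sub>R (c - a) + \<delta> *\<^sub>R (d - a)"
    and int: "tvol a b c d * \<beta> \<in> \<int>" "tvol a b c d * \<gamma> \<in> \<int>" "tvol a b c d * \<delta> \<in> \<int>"
    and nint: "\<not> (\<beta> \<in> \<int> \<and> \<gamma> \<in> \<int> \<and> \<delta> \<in> \<int>)"
    using tvol_Ints_nonunit[OF abcd vol] by blast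
  define Q where "Q m \<longleftrightarrow> 0 < m \<and> real m * \<beta> \<in> \<int> \<and> real m * \<gamma> \<in> \<int> \<and> real m * \<delta> \<in> \<int>" for m :: nat
  obtain D :: int where D: "tvol a b c d = D" using tvol_Ints[OF abcd] by (auto elim!: Ints_cases)
  have "Q (nat \<bar>D\<bar>)"
  proof (cases "D \<ge> 0")
    case True
    then show ?thesis using int vol D unfolding Q_def by auto
  next
    case False
    then show ?thesis using int vol D unfolding Q_def by auto
  qed
  \<comment> \<open>\<open>m\<close> is the order of the class of \<open>z\<close>; for \<open>m = p * l\<close> the class of \<open>l * z\<close> has order \<open>p\<close>\<close>
  define m where "m = (LEAST m. Q m)"
  have Qm: "Q m" unfolding m_def by (rule LeastI, rule \<open>Q (nat \<bar>D\<bar>)\<close>)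
  have min: "\<not> Q l" if "l < m" for l using that unfolding m_def by (rule not_less_Least)
  have "m \<noteq> 1" using Qm nint unfolding Q_def by auto
  then obtain p where p: "prime p" "p dvd m" using prime_factor_nat by blast
  then obtain l where l: "m = p * l" by (elim dvdE)
  have m0: "0 < m" using Qm unfolding Q_def by blast
  have l0: "0 < l" using m0 l by (cases l) auto
  have "l < m" using l l0 prime_gt_1_nat[OF p(1)] by simp
  then have nQ: "\<not> Q l" by (rule min)
  have p0: "0 < p" using p(1) by (simp add: prime_gt_0_nat)
  obtain n2 n3 n4 :: int where n: "real m * \<beta> = n2" "real m * \<gamma> = n3" "real m * \<delta> = n4"
    using Qm unfolding Q_def by (auto elim!: Ints_cases)
  have e: "of_int n2 / p = l * \<beta>" "of_int n3 / p = l * \<gamma>" "of_int n4 / p = l * \<delta>"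
    using p0 unfolding n[symmetric] l by simp_all
  show thesis
  proof (rule that[OF p(1), of "int p - n2 - n3 - n4" n2 n3 n4])
    have e1: "of_int (int p - n2 - n3 - n4) / real p = 1 - l * \<beta> - l * \<gamma> - l * \<delta>"
      unfolding e[symmetric] using p0 by (simp add: field_simps)
    have "(of_int (int p - n2 - n3 - n4) / p) *\<^sub>R a + (of_int n2 / p) *\<^sub>R b + (of_int n3 / p) *\<^sub>R c + (of_int n4 / p) *\<^sub>R d
      = a + of_int (int l) *\<^sub>R z"
      unfolding e1 e z(2) by (simp add: algebra_simps)
    then show "(of_int (int p - n2 - n3 - n4) / p) *\<^sub>R a + (of_int n2 / p) *\<^sub>R b + (of_int n3 / p) *\<^sub>R c + (of_int n4 / p) *\<^sub>R d \<in> int_points"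
      using int_points_closed(1)[OF abcd(1) int_points_closed(3)[OF z(1) z(1), of "int l"]] by simp
    show "\<not> (int p dvd int p - n2 - n3 - n4 \<and> int p dvd n2 \<and> int p dvd n3 \<and> int p dvd n4)"
    proof
      assume "int p dvd int p - n2 - n3 - n4 \<and> int p dvd n2 \<and> int p dvd n3 \<and> int p dvd n4"
      then have "of_int n2 / real p \<in> \<int>" "of_int n3 / real p \<in> \<int>" "of_int n4 / real p \<in> \<int>"
        using p0 by (auto elim!: dvdE)
      then show False using nQ l0 unfolding e Q_def by simp
    qed
  qed simp
qed

lemma convex_parallelepiped: "parallelepiped P \<Longrightarrow> convex P"
proof -
  assume "parallelepiped P"
  then obtain f :: "real^3 \<Rightarrow> real^3" and s where f: "linear f" and P: "P = (\<lambda>x. s + f x) ` cbox 0 1"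
    unfolding parallelepiped_def by blast
  have "P = (+) s ` (f ` cbox 0 1)" unfolding P by auto
  then show ?thesis using convex_translation[OF convex_linear_image[OF f convex_box(1)]] by simp
qed

lemma linear_affine_comb4:
  assumes f: "linear f" and "\<alpha> + \<beta> + \<gamma> + \<delta> = (1::real)"
  shows "\<alpha> *\<^sub>R (s + f a) + \<beta> *\<^sub>R (s + f b) + \<gamma> *\<^sub>R (s + f c) + \<delta> *\<^sub>R (s + f d) =
    s + f (\<alpha> *\<^sub>R a + \<beta> *\<^sub>R b + \<gamma> *\<^sub>R c + \<delta> *\<^sub>R d)"
proof -
  have "\<alpha> *\<^sub>R (s + f a) + \<beta> *\<^sub>R (s + f b) + \<gamma> *\<^sub>R (s + f c) + \<delta> *\<^sub>R (s + f d) =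
    (\<alpha> + \<beta> + \<gamma> + \<delta>) *\<^sub>R s + (\<alpha> *\<^sub>R f a + \<beta> *\<^sub>R f b + \<gamma> *\<^sub>R f c + \<delta> *\<^sub>R f d)"
    by (simp add: algebra_simps)
  then show ?thesis using assms by (simp add: linear_add[OF f] linear_scale[OF f])
qed

text \<open>The hypotheses on \<open>x\<close> and \<open>t\<close> say that \<open>t\<close> is the largest of the weights \<open>x, 1 - x, 1 - t, t\<close>.\<close>

lemma reducible_sorted:
  assumes para: "parallelepiped P" and P: "a \<in> P" "b \<in> P" "c \<in> P" "d \<in> P"
    and int: "a \<in> int_points" "b \<in> int_points" "c \<in> int_points" "d \<in> int_points"
    and t: "1 - t \<le> x" "x \<le> t" "t < 1"
    and y: "x *\<^sub>R a + (1 - x) *\<^sub>R b + (1 - t) *\<^sub>R c + t *\<^sub>R d \<in> int_points"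
  shows "reducible P a b c d"
proof -
  define y where "y = x *\<^sub>R a + (1 - x) *\<^sub>R b + (1 - t) *\<^sub>R c + t *\<^sub>R d"
  have y: "y \<in> int_points" using y unfolding y_def .
  obtain f :: "real^3 \<Rightarrow> real^3" and s where f: "linear f" and Pf: "P = (\<lambda>x. s + f x) ` cbox 0 1"
    using para unfolding parallelepiped_def by blast
  obtain a' b' c' d' where box: "a' \<in> cbox 0 1" "b' \<in> cbox 0 1" "c' \<in> cbox 0 1" "d' \<in> cbox 0 1"
    and e: "a = s + f a'" "b = s + f b'" "c = s + f c'" "d = s + f d'"
    using P unfolding Pf by blast
  have inP: "\<alpha> *\<^sub>R a + \<beta> *\<^sub>R b + \<gamma> *\<^sub>R c + \<delta> *\<^sub>R d \<in> P"
    if "\<alpha> *\<^sub>R a' + \<beta> *\<^sub>R b' + \<gamma> *\<^sub>R c' + \<delta> *\<^sub>R d' \<in> cbox 0 1" "\<alpha> + \<beta> + \<gamma> + \<delta> = 1" for \<alpha> \<beta> \<gamma> \<delta>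
    unfolding e linear_affine_comb4[OF f that(2)] Pf using that(1) by blast
  note I = reducibleI[OF _ inP]
  have eq: "(x - 1) *\<^sub>R a + (1 - x) *\<^sub>R b + (1 - t) *\<^sub>R c + t *\<^sub>R d = y - a"
    "x *\<^sub>R a + (- x) *\<^sub>R b + (1 - t) *\<^sub>R c + t *\<^sub>R d = y - b"
    "x *\<^sub>R a + (1 - x) *\<^sub>R b + (1 - t) *\<^sub>R c + (t - 1) *\<^sub>R d = y - d"
    "(1 - x) *\<^sub>R a + x *\<^sub>R b + (t - 1) *\<^sub>R c + (1 - t) *\<^sub>R d = (a + b + d) - y"
    unfolding y_def by (simp_all add: algebra_simps)
  consider
      "(x - 1) *\<^sub>R a' + (1 - x) *\<^sub>R b' + (1 - t) *\<^sub>R c' + t *\<^sub>R d' \<in> cbox 0 1"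
    | "x *\<^sub>R a' + (- x) *\<^sub>R b' + (1 - t) *\<^sub>R c' + t *\<^sub>R d' \<in> cbox 0 1"
    | "x *\<^sub>R a' + (1 - x) *\<^sub>R b' + (1 - t) *\<^sub>R c' + (t - 1) *\<^sub>R d' \<in> cbox 0 1"
    | "(1 - x) *\<^sub>R a' + x *\<^sub>R b' + (t - 1) *\<^sub>R c' + (1 - t) *\<^sub>R d' \<in> cbox 0 1"
    using cube_candidates[OF box t] by auto
  then show ?thesis
  proof cases
    case 1
    show ?thesis by (rule I[OF _ 1]) (use t y int in \<open>auto simp: eq int_points_closed\<close>)
  next
    case 2
    show ?thesis by (rule I[OF _ 2]) (use t y int in \<open>auto simp: eq[simplified] int_points_closed\<close>)
  next
    case 3
    show ?thesis by (rule I[OF _ 3]) (use t y int in \<open>auto simp: eq int_points_closed\<close>)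
  next
    case 4
    show ?thesis by (rule I[OF _ 4]) (use t y int in \<open>auto simp: eq int_points_closed\<close>)
  qed
qed

lemma reducible_paired:
  assumes para: "parallelepiped P" and P: "a \<in> P" "b \<in> P" "c \<in> P" "d \<in> P"
    and int: "a \<in> int_points" "b \<in> int_points" "c \<in> int_points" "d \<in> int_points"
    and x: "0 < x" "x < 1" and t: "0 < t" "t < 1"
    and y: "x *\<^sub>R a + (1 - x) *\<^sub>R b + (1 - t) *\<^sub>R c + t *\<^sub>R d \<in> int_points"
  shows "reducible P a b c d"
proof -
  have y2: "x *\<^sub>R a + (1 - x) *\<^sub>R b + (1 - (1 - t)) *\<^sub>R d + (1 - t) *\<^sub>R c \<in> int_points"
    "t *\<^sub>R d + (1 - t) *\<^sub>R c + (1 - x) *\<^sub>R b + x *\<^sub>R a \<in> int_points"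
    "t *\<^sub>R d + (1 - t) *\<^sub>R c + (1 - (1 - x)) *\<^sub>R a + (1 - x) *\<^sub>R b \<in> int_points"
    using y by (simp_all add: ac_simps)
  consider "1 - t \<le> x \<and> x \<le> t" | "1 - (1 - t) \<le> x \<and> x \<le> 1 - t"
    | "1 - x \<le> t \<and> t \<le> x" | "1 - (1 - x) \<le> t \<and> t \<le> 1 - x" by linarith
  then show ?thesis
  proof cases
    case 1
    then show ?thesis using reducible_sorted[OF para P int _ _ t(2) y] by blast
  next
    case 2
    then have "reducible P a b d c"
      using reducible_sorted[OF para P(1,2,4,3) int(1,2,4,3) _ _ _ y2(1)] t by simp
    then show ?thesis by (rule reducible_perm)
  next
    case 3
    then have "reducible P d c b a"
      using reducible_sorted[OF para P(4,3,2,1) int(4,3,2,1) _ _ _ y2(2)] x by simp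
    then show ?thesis by (blast intro: reducible_perm)
  next
    case 4
    then have "reducible P d c a b"
      using reducible_sorted[OF para P(4,3,1,2) int(4,3,1,2) _ _ _ y2(3)] x by simp
    then show ?thesis by (blast intro: reducible_perm)
  qed
qed

lemma convex_comb4:
  assumes "convex S" "a \<in> S" "b \<in> S" "c \<in> S" "d \<in> S"
    and "0 \<le> \<alpha>" "0 \<le> \<beta>" "0 \<le> \<gamma>" "0 \<le> \<delta>" "\<alpha> + \<beta> + \<gamma> + \<delta> = (1::real)"
  shows "\<alpha> *\<^sub>R a + \<beta> *\<^sub>R b + \<gamma> *\<^sub>R c + \<delta> *\<^sub>R d \<in> S"
proof -
  have "(\<Sum>i<(4::nat). ([\<alpha>, \<beta>, \<gamma>, \<delta>] ! i) *\<^sub>R ([a, b, c, d] ! i)) \<in> S"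
    by (rule convex_sum) (use assms in \<open>auto simp: eval_nat_numeral less_Suc_eq\<close>)
  then show ?thesis by (simp add: eval_nat_numeral)
qed

lemma convex_hull_4:
  "convex hull {a, b, c, d} = {\<alpha> *\<^sub>R a + \<beta> *\<^sub>R b + \<gamma> *\<^sub>R c + \<delta> *\<^sub>R d | \<alpha> \<beta> \<gamma> \<delta>.
     0 \<le> \<alpha> \<and> 0 \<le> \<beta> \<and> 0 \<le> \<gamma> \<and> 0 \<le> \<delta> \<and> \<alpha> + \<beta> + \<gamma> + \<delta> = 1}" (is "_ = ?R")
proof
  show "convex hull {a, b, c, d} \<subseteq> ?R"
  proof
    fix x assume "x \<in> convex hull {a, b, c, d}"
    then obtain u v y where uv: "0 \<le> u" "0 \<le> v" "u + v = 1" "y \<in> convex hull {b, c, d}" "x = u *\<^sub>R a + v *\<^sub>R y"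
      using convex_hull_insert[of "{b, c, d}" a] by auto
    then obtain p q r where pqr: "0 \<le> p" "0 \<le> q" "0 \<le> r" "p + q + r = 1" "y = p *\<^sub>R b + q *\<^sub>R c + r *\<^sub>R d"
      unfolding convex_hull_3 by auto
    have "x = u *\<^sub>R a + (v * p) *\<^sub>R b + (v * q) *\<^sub>R c + (v * r) *\<^sub>R d"
      unfolding uv pqr by (simp add: algebra_simps)
    moreover have "u + v * p + v * q + v * r = u + v * (p + q + r)" by algebra
    then have "u + v * p + v * q + v * r = 1" using pqr uv by simp
    moreover have "0 \<le> v * p" "0 \<le> v * q" "0 \<le> v * r" using uv pqr by auto
    ultimately show "x \<in> ?R" using uv(1) by blast
  qed
  show "?R \<subseteq> convex hull {a, b, c, d}"
    by (clarify, rule convex_comb4) (auto simp: hull_inc)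
qed

lemma reducible_nonunimodular:
  assumes para: "parallelepiped P" and P: "a \<in> P" "b \<in> P" "c \<in> P" "d \<in> P"
    and int: "a \<in> int_points" "b \<in> int_points" "c \<in> int_points" "d \<in> int_points"
    and vol: "tvol a b c d \<noteq> 0" "\<bar>tvol a b c d\<bar> \<noteq> 1"
  shows "reducible P a b c d"
proof -
  obtain p :: nat and n1 n2 n3 n4 :: int where p: "prime p" and sum: "n1 + n2 + n3 + n4 = int p"
    and lat: "(of_int n1 / p) *\<^sub>R a + (of_int n2 / p) *\<^sub>R b + (of_int n3 / p) *\<^sub>R c + (of_int n4 / p) *\<^sub>R d \<in> int_points"
    and nd: "\<not> (int p dvd n1 \<and> int p dvd n2 \<and> int p dvd n3 \<and> int p dvd n4)"
    using prime_order_weights[OF int vol] by blast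
  have p0: "0 < int p" "1 < int p" using p prime_gt_1_nat[OF p] by (auto simp: prime_gt_0_nat)
  have pr: "0 < real p" using p0 by simp
  have pi: "prime (int p)" using p by simp
  \<comment> \<open>reducing \<open>k * n\<close> modulo \<open>p\<close> changes the weights by integers and so keeps the combination integral\<close>
  define r where "r k n = (k * n) mod int p" for k n
  have r0: "0 \<le> r k n" "r k n < int p" for k n unfolding r_def using p0 by auto
  have rlat: "(of_int (r k n1) / p) *\<^sub>R a + (of_int (r k n2) / p) *\<^sub>R b + (of_int (r k n3) / p) *\<^sub>R c
      + (of_int (r k n4) / p) *\<^sub>R d \<in> int_points" for k
  proof -
    define q where "q n = (k * n) div int p" for n
    have "k * n = q n * int p + r k n" for n unfolding q_def r_def by simp
    then have kn: "real_of_int (k * n) = real_of_int (q n * int p + r k n)" for n by presburger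
    then have e: "of_int (r k n) / real p = of_int k * (of_int n / p) - of_int (q n)" for n
      using pr kn[of n] by (simp add: field_simps)
    have "(of_int (r k n1) / p) *\<^sub>R a + (of_int (r k n2) / p) *\<^sub>R b + (of_int (r k n3) / p) *\<^sub>R c + (of_int (r k n4) / p) *\<^sub>R d
      = of_int k *\<^sub>R ((of_int n1 / p) *\<^sub>R a + (of_int n2 / p) *\<^sub>R b + (of_int n3 / p) *\<^sub>R c + (of_int n4 / p) *\<^sub>R d)
        - of_int (q n1) *\<^sub>R a - of_int (q n2) *\<^sub>R b - of_int (q n3) *\<^sub>R c - of_int (q n4) *\<^sub>R d"
      unfolding e by (simp add: algebra_simps)
    then show ?thesis using lat int by (simp add: int_points_closed)
  qed
  define R where "R k = r k n1 + r k n2 + r k n3 + r k n4" for k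
  show ?thesis
  proof (cases "\<exists>k. R k = int p")
    case True
    then obtain k where k: "R k = int p" ..
    have s: "of_int (r k n1) / p + of_int (r k n2) / p + of_int (r k n3) / p + of_int (r k n4) / real p = 1"
    proof -
      have "real_of_int (R k) = p" using k by simp
      then show ?thesis unfolding R_def using pr by (simp add: field_simps)
    qed
    have lt: "of_int (r k n) / real p < 1" "0 \<le> of_int (r k n) / real p" for n
      using r0[where k=k and n=n] pr by (simp_all add: field_simps)
    show ?thesis
      by (rule reducibleI[OF rlat convex_comb4[OF convex_parallelepiped[OF para] P lt(2) lt(2) lt(2) lt(2) s]
            lt(1) lt(1) lt(1) lt(1) s])
  next
    case False
    have Rp: "int p dvd R k" for k
    proof -
      have "R k = k * (n1 + n2 + n3 + n4) - int p * ((k * n1) div int p + (k * n2) div int p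
          + (k * n3) div int p + (k * n4) div int p)"
        unfolding R_def r_def minus_mult_div_eq_mod[symmetric] by algebra
      then show ?thesis unfolding sum by simp
    qed
    \<comment> \<open>the sums at \<open>k\<close> and \<open>p - k\<close> are each at least \<open>2 * p\<close> and together at most \<open>4 * p\<close>\<close>
    have R2: "2 * int p \<le> R k" if k: "0 < k" "k < int p" for k
    proof -
      have "\<not> int p dvd k" using k zdvd_imp_le by fastforce
      then have "\<not> (int p dvd k * n1 \<and> int p dvd k * n2 \<and> int p dvd k * n3 \<and> int p dvd k * n4)"
        using nd pi by (simp add: prime_dvd_mult_iff)
      then have "\<not> (r k n1 = 0 \<and> r k n2 = 0 \<and> r k n3 = 0 \<and> r k n4 = 0)"
        unfolding r_def by (simp add: dvd_eq_mod_eq_0)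
      then have "0 < R k" using r0(1)[of k n1] r0(1)[of k n2] r0(1)[of k n3] r0(1)[of k n4] unfolding R_def by linarith
      moreover obtain i where i: "R k = int p * i" using Rp[of k] by (elim dvdE)
      ultimately have "0 < i" using p0 by (simp add: zero_less_mult_iff)
      moreover have "i \<noteq> 1" using False i by auto
      ultimately have "2 \<le> i" by linarith
      then show ?thesis unfolding i using p0 by simp
    qed
    have rneg: "r k n + r (int p - k) n = (if r k n = 0 then 0 else int p)" for k n
    proof -
      have "r (int p - k) n = (- (k * n)) mod int p"
        unfolding r_def by (metis left_diff_distrib mod_mult_self1_is_0 diff_0 mod_diff_left_eq)
      then show ?thesis unfolding r_def by (simp add: zmod_zminus1_eq_if)
    qed
    have full: "R k = 2 * int p \<and> r k n1 \<noteq> 0 \<and> r k n2 \<noteq> 0 \<and> r k n3 \<noteq> 0 \<and> r k n4 \<noteq> 0"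
      if k: "0 < k" "k < int p" for k
    proof -
      have "2 * int p \<le> R k" "2 * int p \<le> R (int p - k)" using R2 k by auto
      then show ?thesis
        using rneg[of k n1] rneg[of k n2] rneg[of k n3] rneg[of k n4] p0 unfolding R_def
        by (auto split: if_splits)
    qed
    have one: "r 1 n \<noteq> 0 \<longleftrightarrow> \<not> int p dvd n" for n unfolding r_def by (simp add: dvd_eq_mod_eq_0)
    have full1: "R 1 = 2 * int p" "r 1 n1 \<noteq> 0" "r 1 n2 \<noteq> 0" "r 1 n3 \<noteq> 0" "r 1 n4 \<noteq> 0"
      using full[of 1] p0 by auto
    have "int p dvd n1 + n2 \<or> int p dvd n1 + n3 \<or> int p dvd n1 + n4"
      by (rule residue_sums_pairing[OF p]) (use full full1 in \<open>auto simp: one[symmetric] r_def R_def\<close>)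
    moreover have pair: "r 1 m + r 1 n = int p" if "int p dvd m + n" "r 1 m \<noteq> 0" for m n
    proof -
      have "(r 1 m + r 1 n) mod int p = 0" unfolding r_def using that(1) by (simp add: mod_simps dvd_eq_mod_eq_0)
      then have "int p dvd r 1 m + r 1 n" by (simp add: dvd_eq_mod_eq_0)
      then obtain i where i: "r 1 m + r 1 n = int p * i" by (elim dvdE)
      moreover have "0 < r 1 m" "0 \<le> r 1 n" "r 1 m < int p" "r 1 n < int p" using r0 that(2) by (auto simp: less_le)
      ultimately have "0 < int p * i" "int p * i < int p * 2" by linarith+
      then have "0 < i" "i < 2" using p0 by (simp_all add: zero_less_mult_iff)
      then have "i = 1" by linarith
      then show ?thesis using i by simp
    qed
    define x where "x n = real_of_int (r 1 n) / p" for n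
    have x: "0 < x n" "x n < 1" if "r 1 n \<noteq> 0" for n
      unfolding x_def using r0[of 1 n] that pr by (simp_all add: field_simps less_le)
    have pairx: "x n = 1 - x m" if "r 1 m + r 1 n = int p" for m n
    proof -
      have "real_of_int (r 1 m + r 1 n) = p" using that by simp
      then show ?thesis unfolding x_def using pr by (simp add: field_simps)
    qed
    have y: "x n1 *\<^sub>R a + x n2 *\<^sub>R b + x n3 *\<^sub>R c + x n4 *\<^sub>R d \<in> int_points"
      using rlat[of 1] unfolding x_def .
    note x4 = x(1)[OF full1(2)] x(2)[OF full1(2)] x(1)[OF full1(5)] x(2)[OF full1(5)]
      x(1)[OF full1(3)] x(2)[OF full1(3)]
    ultimately consider "int p dvd n1 + n2" | "int p dvd n1 + n3" | "int p dvd n1 + n4" by blast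
    then show ?thesis
    proof cases
      case 1
      have e: "r 1 n1 + r 1 n2 = int p" using pair[OF 1 full1(2)] .
      then have e': "r 1 n4 + r 1 n3 = int p" using full1(1) unfolding R_def by linarith
      show ?thesis
        by (rule reducible_paired[OF para P int x4(1-4)]) (use y in \<open>simp add: pairx[OF e] pairx[OF e'] ac_simps\<close>)
    next
      case 2
      have e: "r 1 n1 + r 1 n3 = int p" using pair[OF 2 full1(2)] .
      then have e': "r 1 n4 + r 1 n2 = int p" using full1(1) unfolding R_def by linarith
      have "reducible P a c b d"
        by (rule reducible_paired[OF para P(1,3,2,4) int(1,3,2,4) x4(1-4)])
          (use y in \<open>simp add: pairx[OF e] pairx[OF e'] ac_simps\<close>)
      then show ?thesis by (rule reducible_perm)
    next
      case 3
      have e: "r 1 n1 + r 1 n4 = int p" using pair[OF 3 full1(2)] .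
      then have e': "r 1 n2 + r 1 n3 = int p" using full1(1) unfolding R_def by linarith
      have "reducible P a d c b"
        by (rule reducible_paired[OF para P(1,4,3,2) int(1,4,3,2) x4(1,2,5,6)])
          (use y in \<open>simp add: pairx[OF e] pairx[OF e'] ac_simps\<close>)
      then show ?thesis by (rule reducible_perm)
    qed
  qed
qed

section \<open>Covering by induction on the volume\<close>

text \<open>
  Let \<open>m\<close> and \<open>l\<close> be the barycentric coordinates of \<open>x\<close> and \<open>e\<close>. Among the vertices with positive
  \<open>l\<close>-coordinate, exchange one that minimizes the ratio \<open>m / l\<close>: all coordinates of \<open>x\<close> remain
  nonnegative. The condition is cross-multiplied, so that it holds trivially for the vertices with \<open>l \<le> 0\<close>.
\<close>

lemma convex_hull_exchange4:
  fixes a b c d :: "'a :: real_vector"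
  assumes x: "x = m1 *\<^sub>R a + m2 *\<^sub>R b + m3 *\<^sub>R c + m4 *\<^sub>R d" "m1 + m2 + m3 + m4 = 1"
    and e: "e = l1 *\<^sub>R a + l2 *\<^sub>R b + l3 *\<^sub>R c + l4 *\<^sub>R d" "l1 + l2 + l3 + l4 = 1"
    and m: "0 \<le> m1" and l: "0 < l1"
    and min: "m1 * l2 \<le> m2 * l1" "m1 * l3 \<le> m3 * l1" "m1 * l4 \<le> m4 * l1"
  shows "x \<in> convex hull {e, b, c, d}"
proof -
  define s where "s = m1 / l1"
  have s: "0 \<le> s" "m1 = s * l1" unfolding s_def using m l by auto
  have nn: "0 \<le> m2 - s * l2" "0 \<le> m3 - s * l3" "0 \<le> m4 - s * l4"
    unfolding s_def using min l by (simp_all add: field_simps)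
  have "x = s *\<^sub>R e + (m2 - s * l2) *\<^sub>R b + (m3 - s * l3) *\<^sub>R c + (m4 - s * l4) *\<^sub>R d"
    unfolding x(1) e(1) s(2) by (simp add: algebra_simps)
  moreover have "s + (m2 - s * l2) + (m3 - s * l3) + (m4 - s * l4) = 1"
  proof -
    have "s + (m2 - s * l2) + (m3 - s * l3) + (m4 - s * l4) = s - s * (l1 + l2 + l3 + l4) + (m1 + m2 + m3 + m4)"
      unfolding s(2) by algebra
    then show ?thesis using x(2) e(2) by simp
  qed
  ultimately show ?thesis unfolding convex_hull_4 using s(1) nn by blast
qed

text \<open>A pair consists of the coordinates \<open>l\<close> and \<open>m\<close> of one vertex, in the notation of the preceding lemma.\<close>

lemma exists_min_ratio:
  fixes S :: "(real \<times> real) set"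
  assumes S: "finite S" "\<exists>q\<in>S. 0 < fst q" and nn: "\<And>q. q \<in> S \<Longrightarrow> 0 \<le> snd q"
  shows "\<exists>q\<in>S. 0 < fst q \<and> (\<forall>r\<in>S. snd q * fst r \<le> snd r * fst q)"
proof -
  define S' where "S' = {q \<in> S. 0 < fst q}"
  have fin: "finite ((\<lambda>q. snd q / fst q) ` S')" "(\<lambda>q. snd q / fst q) ` S' \<noteq> {}"
    unfolding S'_def using S by auto
  obtain q where q: "q \<in> S'" "snd q / fst q = Min ((\<lambda>q. snd q / fst q) ` S')"
    using Min_in[OF fin] by auto
  have q0: "0 < fst q" "q \<in> S" using q(1) unfolding S'_def by auto
  have "snd q * fst r \<le> snd r * fst q" if r: "r \<in> S" for r
  proof (cases "0 < fst r")
    case True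
    then have "snd q / fst q \<le> snd r / fst r"
      unfolding q(2) using r fin(1) by (intro Min_le) (auto simp: S'_def)
    then show ?thesis using True q0 by (simp add: field_simps)
  next
    case False
    then have "snd q * fst r \<le> 0" using nn[OF q0(2)] by (simp add: mult_nonneg_nonpos)
    also have "0 \<le> snd r * fst q" using nn[OF r] q0 by simp
    finally show ?thesis .
  qed
  then show ?thesis using q0 by blast
qed

lemma tvol_transpose:
  "tvol b a c d = - tvol a b c d" "tvol c b a d = - tvol a b c d" "tvol d b c a = - tvol a b c d"
proof -
  have last: "tvol a b d c = - tvol a b c d" for a b c d
    unfolding tvol_def by (subst cross_skew) simp
  show 1: "tvol b a c d = - tvol a b c d" for a b c d by (rule tvol_swap)
  show 2: "tvol c b a d = - tvol a b c d" for a b c d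
    using tvol_rotate[of b a d c] tvol_swap[of b a d c] last[of a b d c] by simp
  show "tvol d b c a = - tvol a b c d"
    using tvol_rotate[of b c a d] tvol_swap[of c b a d] 2[of c b a d] by simp
qed

lemma covered_by_unimodular:
  assumes para: "parallelepiped P"
  assumes "a \<in> int_points" "b \<in> int_points" "c \<in> int_points" "d \<in> int_points"
    and "a \<in> P" "b \<in> P" "c \<in> P" "d \<in> P"
    and "\<bar>tvol a b c d\<bar> = real n" "0 < n" and "x \<in> convex hull {a, b, c, d}"
  shows "\<exists>T. unimodular_tetrahedron T \<and> T \<subseteq> P \<and> x \<in> T"
  using assms(2-)
proof (induction n arbitrary: a b c d rule: less_induct)
  case (less n)
  note int = less.prems(1-4) and P = less.prems(5-8) and vol = less.prems(9,10) and x = less.prems(11)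
  show ?case
  proof (cases "n = 1")
    case True
    have "convex hull {a, b, c, d} \<subseteq> P"
      using P convex_parallelepiped[OF para] by (intro hull_minimal) auto
    moreover have "unimodular_tetrahedron (convex hull {a, b, c, d})"
      using True vol by (intro unimodular_hull int) simp
    ultimately show ?thesis using x by blast
  next
    case False
    have "reducible P a b c d"
      using False vol by (intro reducible_nonunimodular para int P) auto
    then obtain l1 l2 l3 l4 e where l: "l1 < 1" "l2 < 1" "l3 < 1" "l4 < 1" "l1 + l2 + l3 + l4 = 1"
      and e: "e = l1 *\<^sub>R a + l2 *\<^sub>R b + l3 *\<^sub>R c + l4 *\<^sub>R d" "e \<in> int_points" "e \<in> P"
      unfolding reducible_def by blast
    obtain m1 m2 m3 m4 where m: "0 \<le> m1" "0 \<le> m2" "0 \<le> m3" "0 \<le> m4" "m1 + m2 + m3 + m4 = 1"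
      and xe: "x = m1 *\<^sub>R a + m2 *\<^sub>R b + m3 *\<^sub>R c + m4 *\<^sub>R d"
      using x unfolding convex_hull_4 by blast
    \<comment> \<open>replacing \<open>A\<close> by \<open>e\<close>; the four vertices of the tetrahedron take the place of \<open>A\<close> in turn\<close>
    have step: ?thesis if ABCD: "A \<in> int_points" "B \<in> int_points" "C \<in> int_points" "D \<in> int_points"
        "A \<in> P" "B \<in> P" "C \<in> P" "D \<in> P" "\<bar>tvol A B C D\<bar> = real n"
      and E: "e = k1 *\<^sub>R A + k2 *\<^sub>R B + k3 *\<^sub>R C + k4 *\<^sub>R D" "k1 + k2 + k3 + k4 = 1"
      and X: "x = p1 *\<^sub>R A + p2 *\<^sub>R B + p3 *\<^sub>R C + p4 *\<^sub>R D" "p1 + p2 + p3 + p4 = 1"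
      and p: "0 \<le> p1" and k: "0 < k1" "k1 < 1"
      and min: "p1 * k2 \<le> p2 * k1" "p1 * k3 \<le> p3 * k1" "p1 * k4 \<le> p4 * k1"
      for A B C D k1 k2 k3 k4 p1 p2 p3 p4
    proof -
      have v: "\<bar>tvol e B C D\<bar> = k1 * real n"
        unfolding tvol_replace[OF E] using k ABCD(9) by (simp add: abs_mult)
      obtain j :: int where j: "tvol e B C D = j"
        using tvol_Ints[OF e(2) ABCD(2-4)] by (auto elim!: Ints_cases)
      have "real (nat \<bar>j\<bar>) = \<bar>tvol e B C D\<bar>" unfolding j by simp
      moreover have "0 < k1 * real n" "k1 * real n < real n" using k vol(2) by auto
      ultimately have "nat \<bar>j\<bar> < n" "0 < nat \<bar>j\<bar>" "\<bar>tvol e B C D\<bar> = real (nat \<bar>j\<bar>)"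
        unfolding v by linarith+
      moreover have "x \<in> convex hull {e, B, C, D}" by (rule convex_hull_exchange4[OF X E p k(1) min])
      ultimately show ?thesis using less.IH e(2,3) ABCD by blast
    qed
    have "\<exists>q\<in>{(l1, m1), (l2, m2), (l3, m3), (l4, m4)}. 0 < fst q \<and>
        (\<forall>r\<in>{(l1, m1), (l2, m2), (l3, m3), (l4, m4)}. snd q * fst r \<le> snd r * fst q)"
      using l m by (intro exists_min_ratio) auto
    then consider
        "0 < l1" "m1 * l2 \<le> m2 * l1" "m1 * l3 \<le> m3 * l1" "m1 * l4 \<le> m4 * l1"
      | "0 < l2" "m2 * l1 \<le> m1 * l2" "m2 * l3 \<le> m3 * l2" "m2 * l4 \<le> m4 * l2"
      | "0 < l3" "m3 * l2 \<le> m2 * l3" "m3 * l1 \<le> m1 * l3" "m3 * l4 \<le> m4 * l3"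
      | "0 < l4" "m4 * l2 \<le> m2 * l4" "m4 * l3 \<le> m3 * l4" "m4 * l1 \<le> m1 * l4"
      by auto
    then show ?thesis
    proof cases
      case 1
      show ?thesis
        by (rule step[OF int P vol(1) e(1) l(5) xe m(5) m(1) 1(1) l(1) 1(2-4)])
    next
      case 2
      show ?thesis
        by (rule step[OF int(2,1,3,4) P(2,1,3,4) _ _ _ _ _ m(2) 2(1) l(2) 2(2-4)])
          (use vol l m e xe in \<open>simp_all add: tvol_transpose[of b a c d] ac_simps\<close>)
    next
      case 3
      show ?thesis
        by (rule step[OF int(3,2,1,4) P(3,2,1,4) _ _ _ _ _ m(3) 3(1) l(3) 3(2-4)])
          (use vol l m e xe in \<open>simp_all add: tvol_transpose(2)[of c b a d] ac_simps\<close>)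
    next
      case 4
      show ?thesis
        by (rule step[OF int(4,2,3,1) P(4,2,3,1) _ _ _ _ _ m(4) 4(1) l(4) 4(2-4)])
          (use vol l m e xe in \<open>simp_all add: tvol_transpose(3)[of d b c a] ac_simps\<close>)
    qed
  qed
qed

lemma tvol_nonzero:
  assumes ind: "\<not> affine_dependent {a, b, c, d}" and dist: "distinct [a, b, c, d]"
  shows "tvol a b c d \<noteq> 0"
proof
  assume 0: "tvol a b c d = 0"
  define u v w where "u = b - a" "v = c - a" "w = d - a"
  have ne: "u \<noteq> v" "u \<noteq> w" "v \<noteq> w" using dist unfolding u_v_w_def by auto
  have "(\<lambda>x. - a + x) ` {b, c, d} = {u, v, w}" unfolding u_v_w_def by auto
  then have ind3: "independent {u, v, w}"
    using affine_dependent_iff_dependent[of a "{b, c, d}"] dist ind by auto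
  have "v \<times> w = 0"
  proof -
    have "card {u, v, w} = 3" using ne by simp
    then have "dim (UNIV :: (real^3) set) \<le> card {u, v, w}" by simp
    then have "UNIV \<subseteq> span {u, v, w}"
      using ind3 by (intro card_ge_dim_independent) auto
    moreover have "orthogonal (v \<times> w) y" if "y \<in> {u, v, w}" for y
      using that 0 unfolding tvol_def u_v_w_def[symmetric]
      by (auto simp: orthogonal_def dot_cross_self inner_commute)
    ultimately have "orthogonal (v \<times> w) (v \<times> w)"
      using orthogonal_to_span[of "v \<times> w" "{u, v, w}" "v \<times> w"] by blast
    then show ?thesis by (simp add: orthogonal_def)
  qed
  then have "collinear {0, v, w}" by (simp add: cross_eq_0)
  then have "v = 0 \<or> w = 0 \<or> (\<exists>k. w = k *\<^sub>R v)" by (simp add: collinear_lemma)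
  moreover have "v \<noteq> 0" "w \<noteq> 0" using ind3 by (metis dependent_zero insertI1 insertI2)+
  moreover have "w \<notin> span ({u, v, w} - {w})"
    using ind3 unfolding dependent_def by blast
  moreover have "v \<in> span ({u, v, w} - {w})" using ne by (auto intro: span_base)
  ultimately show False using span_scale by blast
qed

text \<open>A subset of least cardinality whose convex hull contains \<open>x\<close> is affinely independent.\<close>

lemma caratheodory_affine_independent:
  fixes x :: "'a :: euclidean_space"
  assumes "x \<in> convex hull E"
  obtains S where "S \<subseteq> E" "\<not> affine_dependent S" "x \<in> convex hull S"
proof -
  have car: "\<exists>S'. finite S' \<and> S' \<subseteq> S \<and> int (card S') \<le> aff_dim S + 1 \<and> x \<in> convex hull S'"
    if "x \<in> convex hull S" for S
  proof -
    have "x \<in> {x. \<exists>S'. finite S' \<and> S' \<subseteq> S \<and> int (card S') \<le> aff_dim S + 1 \<and> x \<in> convex hull S'}"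
      using that by (simp only: caratheodory_aff_dim[symmetric])
    then show ?thesis by simp
  qed
  define Q where "Q n \<longleftrightarrow> (\<exists>S. finite S \<and> S \<subseteq> E \<and> card S = n \<and> x \<in> convex hull S)" for n
  obtain n where "Q n" using car[OF assms] unfolding Q_def by blast
  define N where "N = (LEAST n. Q n)"
  have "Q N" unfolding N_def by (rule LeastI, rule \<open>Q n\<close>)
  then obtain S where S: "finite S" "S \<subseteq> E" "card S = N" "x \<in> convex hull S" unfolding Q_def by blast
  obtain S' where S': "finite S'" "S' \<subseteq> S" "int (card S') \<le> aff_dim S + 1" "x \<in> convex hull S'"
    using car[OF S(4)] by blast
  have "Q (card S')" unfolding Q_def using S' S(2) by blast
  then have "N \<le> card S'" unfolding N_def by (rule Least_le)
  then have "int (card S) \<le> aff_dim S + 1" using S' S(3) by linarith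
  moreover have "aff_dim S \<le> int (card S) - 1" using S(1) by (rule aff_dim_le_card)
  ultimately have "\<not> affine_dependent S" using S(1) by (simp add: affine_independent_iff_card)
  then show thesis using S that by blast
qed

section \<open>Unimodular covers of lattice parallelepipeds\<close>

theorem theorem1p2:
  fixes P :: "(real ^ 3) set"
  assumes "lattice_parallelepiped P" and "aff_dim P = 3"
  shows "\<exists>\<T>. unimodular_cover \<T> P"
proof -
  have para: "parallelepiped P" and lat: "{v. v extreme_point_of P} \<subseteq> int_points"
    using assms(1) unfolding lattice_parallelepiped_def by auto
  define E where "E = {v. v extreme_point_of P}"
  have EP: "E \<subseteq> P" unfolding E_def extreme_point_of_def by auto
  have "compact P"
  proof -
    obtain f :: "real^3 \<Rightarrow> real^3" and s where f: "linear f" and Pf: "P = (\<lambda>x. s + f x) ` cbox 0 1"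
      using para unfolding parallelepiped_def by blast
    show ?thesis unfolding Pf
      by (intro compact_continuous_image continuous_intros linear_continuous_on f
        linear_conv_bounded_linear[THEN iffD1] compact_cbox)
  qed
  then have PE: "P = convex hull E"
    unfolding E_def using convex_parallelepiped[OF para] by (rule Krein_Milman_Minkowski)
  have "\<exists>T. unimodular_tetrahedron T \<and> T \<subseteq> P \<and> x \<in> T" if x: "x \<in> P" for x
  proof -
    obtain S where S: "S \<subseteq> E" "\<not> affine_dependent S" "x \<in> convex hull S"
      using caratheodory_affine_independent x PE by blast
    have "S \<noteq> {}" using S(3) by auto
    then obtain V where V: "\<not> affine_dependent V" "S \<subseteq> V" "V \<subseteq> E" "affine hull V = affine hull E"
      using extend_to_affine_basis_nonempty[OF S(2,1)] by blast
    have "aff_dim V = 3"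
      using assms(2) V(4) PE by (metis aff_dim_affine_hull aff_dim_convex_hull)
    then have "card V = 4" using aff_dim_affine_independent[OF V(1)] by simp
    then obtain a b c d where abcd: "V = {a, b, c, d}" "distinct [a, b, c, d]"
      by (auto simp: card_Suc_eq eval_nat_numeral)
    have int: "a \<in> int_points" "b \<in> int_points" "c \<in> int_points" "d \<in> int_points"
      and P: "a \<in> P" "b \<in> P" "c \<in> P" "d \<in> P"
      using V(3) lat EP abcd(1) unfolding E_def by auto
    have "tvol a b c d \<noteq> 0" using tvol_nonzero V(1) abcd by blast
    moreover obtain n :: int where n: "tvol a b c d = n" using tvol_Ints[OF int] by (auto elim!: Ints_cases)
    ultimately have "\<bar>tvol a b c d\<bar> = real (nat \<bar>n\<bar>)" "0 < nat \<bar>n\<bar>" by auto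
    moreover have "x \<in> convex hull {a, b, c, d}"
      using S(3) V(2) hull_mono abcd(1) by blast
    ultimately show ?thesis by (rule covered_by_unimodular[OF para int P])
  qed
  then have "unimodular_cover {T. unimodular_tetrahedron T \<and> T \<subseteq> P} P"
    unfolding unimodular_cover_def by blast
  then show ?thesis by blast
qed

end
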